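(* For any lattice congruence $\equiv$ of the weak order on $S_n$, the graph $G(L(S_n/\!\equiv))$ has a Hamiltonian cycle.
   Context: The weak order on the set $S_n$ of permutations of $[n]$ is the inclusion order of inversion sets; its cover relations are adjacent transpositions, and it is a lattice. A lattice congruence is an equivalence relation $\equiv$ on a lattice with $x\equiv x'$, $y\equiv y'$ implying $x\vee y\equiv x'\vee y'$ and $x\wedge y\equiv x'\wedge y'$. The quotient $S_n/\!\equiv$ is realized by a polytope (the quotientope) whose skeleton is the cover graph of the quotient lattice $S_n/\!\equiv$. Combinatorially, the nonempty faces of the quotientope are the equivalence classes of nonempty faces of the permutahedron $\Pi_n$ under the relation: two faces $F,F'$ of $\Pi_n$ (viewed as sets of permutations) are equivalent if every $\pi\in F$ is $\equiv$-equivalent to some $\pi'\in F'$ and vice versa; a class $\mathfrak F$ lies below a class $\mathfrak F'$ if some representative of $\mathfrak F$ is contained in some representative of $\mathfrak F'$. $L(S_n/\!\equiv)$ denotes the face lattice of the quotientope (including the empty face), and $G(L(S_n/\!\equiv))$ its cover graph, whose edges join faces $F\subset F'$ with $\dim F'=\dim F+1$. *)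

theory Defs
  imports Complex_Main "HOL-Combinatorics.Permutations" "HOL-Algebra.Lattice"
begin

definition perms :: "nat \<Rightarrow> (nat \<Rightarrow> nat) set" where
  "perms n = {\<pi>. \<pi> permutes {1..n}}"

(* Inversions are pairs of values, so the cover relations of the weak order exchange
   the entries in two adjacent positions. *)
definition inversions :: "nat \<Rightarrow> (nat \<Rightarrow> nat) \<Rightarrow> (nat \<times> nat) set" where
  "inversions n \<pi> = {(\<pi> i, \<pi> j) | i j. i \<in> {1..n} \<and> j \<in> {1..n} \<and> i < j \<and> \<pi> i > \<pi> j}"

definition weak_order :: "nat \<Rightarrow> (nat \<Rightarrow> nat) gorder" where
  "weak_order n = \<lparr>carrier = perms n, eq = (=),
     le = (\<lambda>\<pi> \<rho>. inversions n \<pi> \<subseteq> inversions n \<rho>)\<rparr>"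

definition lattice_congruence :: "('a, 'b) gorder_scheme \<Rightarrow> ('a \<times> 'a) set \<Rightarrow> bool" where
  "lattice_congruence L R \<longleftrightarrow> equiv (carrier L) R \<and>
     (\<forall>x x' y y'. (x, x') \<in> R \<longrightarrow> (y, y') \<in> R \<longrightarrow>
        (x \<squnion>\<^bsub>L\<^esub> y, x' \<squnion>\<^bsub>L\<^esub> y') \<in> R \<and> (x \<sqinter>\<^bsub>L\<^esub> y, x' \<sqinter>\<^bsub>L\<^esub> y') \<in> R)"

(* Points of R^n are functions nat => real of which only the coordinates 1..n matter.
   The permutation pi is placed at the point (pi^{-1}(1), ..., pi^{-1}(n)).  With the
   inversions taken as pairs of values this is the labelling of the vertices for which the
   edges of the permutahedron are exactly the cover relations of the weak order. *)
definition perm_point :: "nat \<Rightarrow> (nat \<Rightarrow> nat) \<Rightarrow> nat \<Rightarrow> real" where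
  "perm_point n \<pi> = (\<lambda>i. if i \<in> {1..n} then real (inv \<pi> i) else 0)"

(* The convex hull of the points of all permutations, written out because the library's
   convex hull is not available for the type nat => real. *)
definition permutahedron :: "nat \<Rightarrow> (nat \<Rightarrow> real) set" where
  "permutahedron n = {(\<lambda>i. \<Sum>\<pi>\<in>perms n. w \<pi> * perm_point n \<pi> i) | w.
     (\<forall>\<pi>\<in>perms n. 0 \<le> w \<pi>) \<and> (\<Sum>\<pi>\<in>perms n. w \<pi>) = 1}"

(* A face of a polytope is the set of its points that satisfy a valid linear inequality
   with equality.  The empty face and the polytope itself arise from c = 0. *)
definition is_face :: "nat \<Rightarrow> (nat \<Rightarrow> real) set \<Rightarrow> (nat \<Rightarrow> real) set \<Rightarrow> bool" where
  "is_face n F P \<longleftrightarrow> (\<exists>c b. (\<forall>x\<in>P. (\<Sum>i=1..n. c i * x i) \<le> b) \<and>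
     F = {x \<in> P. (\<Sum>i=1..n. c i * x i) = b})"

(* The faces of the permutahedron, the empty one included, as sets of permutations. *)
definition perm_faces :: "nat \<Rightarrow> (nat \<Rightarrow> nat) set set" where
  "perm_faces n = {{\<pi> \<in> perms n. perm_point n \<pi> \<in> F} | F. is_face n F (permutahedron n)}"

definition face_equiv ::
  "nat \<Rightarrow> ((nat \<Rightarrow> nat) \<times> (nat \<Rightarrow> nat)) set \<Rightarrow> ((nat \<Rightarrow> nat) set \<times> (nat \<Rightarrow> nat) set) set" where
  "face_equiv n R = {(F, F'). F \<in> perm_faces n \<and> F' \<in> perm_faces n \<and>
     (\<forall>\<pi>\<in>F. \<exists>\<pi>'\<in>F'. (\<pi>, \<pi>') \<in> R) \<and> (\<forall>\<pi>'\<in>F'. \<exists>\<pi>\<in>F. (\<pi>, \<pi>') \<in> R)}"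

(* The empty face of the permutahedron is equivalent only to itself; its class {{}} is
   the empty face of the quotientope and the least element. *)
definition quotientope_face_lattice ::
  "nat \<Rightarrow> ((nat \<Rightarrow> nat) \<times> (nat \<Rightarrow> nat)) set \<Rightarrow> (nat \<Rightarrow> nat) set set gorder" where
  "quotientope_face_lattice n R = \<lparr>carrier = perm_faces n // face_equiv n R, eq = (=),
     le = (\<lambda>A B. \<exists>F\<in>A. \<exists>F'\<in>B. F \<subseteq> F')\<rparr>"

definition covers :: "('a, 'b) gorder_scheme \<Rightarrow> 'a \<Rightarrow> 'a \<Rightarrow> bool" where
  "covers L x y \<longleftrightarrow> x \<in> carrier L \<and> y \<in> carrier L \<and> x \<sqsubset>\<^bsub>L\<^esub> y \<and>
     \<not> (\<exists>z\<in>carrier L. x \<sqsubset>\<^bsub>L\<^esub> z \<and> z \<sqsubset>\<^bsub>L\<^esub> y)"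

definition cover_adjacent :: "('a, 'b) gorder_scheme \<Rightarrow> 'a \<Rightarrow> 'a \<Rightarrow> bool" where
  "cover_adjacent L x y \<longleftrightarrow> covers L x y \<or> covers L y x"

(* A cyclic enumeration of the vertices in which cyclically consecutive ones are adjacent.
   For at least three vertices this is a Hamiltonian cycle in the usual sense.  The single
   edge K_2, traversed back and forth, is admitted; it is the cover graph of the face
   lattice of a point, which is the quotientope of the congruence with only one class. *)
definition hamiltonian_cycle :: "'a set \<Rightarrow> ('a \<Rightarrow> 'a \<Rightarrow> bool) \<Rightarrow> 'a list \<Rightarrow> bool" where
  "hamiltonian_cycle V E xs \<longleftrightarrow> xs \<noteq> [] \<and> distinct xs \<and> set xs = V \<and>
     (\<forall>i<length xs. E (xs ! i) (xs ! ((i + 1) mod length xs)))"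

end

theory Submission
  imports Defs
begin

text \<open>The cycle is built by induction on \<open>n\<close>, for all congruences at once. A nonempty face of the
  permutahedron is given by a function \<open>c\<close> on \<open>{1..n}\<close> (equal values form the blocks of an ordered
  set partition) and is the weak order interval of the permutations whose inversion set lies between
  \<open>lo n c\<close> and \<open>hi n c\<close>; two faces are equivalent iff their minima and their maxima are congruent.
  A face of size \<open>n\<close> lifts to size \<open>n + 1\<close> by choosing the value of \<open>n + 1\<close>, and as this value
  decreases the lifts form a path between \<open>n + 1\<close> in last and \<open>n + 1\<close> in first position, alternating
  between new singleton blocks and insertions into a block. An insertion whose face is contracted by
  the congruence coincides with both of its neighbours; the remaining insertions raise the dimension
  by one. The lifts of equivalent faces agree up to equivalence, so all of these paths can be
  concatenated, alternately forwards and backwards, along a Hamiltonian path of the nonempty faces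
  of size \<open>n\<close>. Both ends have dimension zero, so the empty face closes the cycle.\<close>

subsection \<open>Inversion sets and congruences\<close>

text \<open>Inversion sets are used because the join there is a transitive closure, and because
  removing \<open>n + 1\<close> or moving it from last to first place is a meet or a join with one
  fixed element, so every congruence respects it. The obstacle is that equivalent faces may have
  different blocks: their lifts do not match block by block, and a path built from one
  representative must still be shown to reach the lifts of all others. Covers are certified by an
  integer rank. Each stage of the recursion adds 0 to it for a thin lift and 1 otherwise. The rank
  is constant on classes and strictly increasing along containment of inequivalent faces, so
  containment with rank difference one leaves no room for a class in between. Strictness rests on
  one comparison: of two nested inequivalent lifts over equivalent faces, the smaller is thin and
  the larger is not.\<close>

definition pairs :: "nat \<Rightarrow> (nat \<times> nat) set" where
  "pairs n = {(a, b). 1 \<le> b \<and> b < a \<and> a \<le> n}"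

text \<open>The last condition says that the complement in \<open>pairs n\<close> is transitive.
  Together with transitivity it characterises the inversion sets of permutations;
  \<open>inversions_surj\<close> recovers the permutation.\<close>

definition inv_sets :: "nat \<Rightarrow> (nat \<times> nat) set set" where
  "inv_sets n = {I. I \<subseteq> pairs n \<and> trans I \<and>
     (\<forall>a b c. (a, c) \<in> I \<longrightarrow> c < b \<longrightarrow> b < a \<longrightarrow> (a, b) \<in> I \<or> (b, c) \<in> I)}"

definition inv_join :: "(nat \<times> nat) set \<Rightarrow> (nat \<times> nat) set \<Rightarrow> (nat \<times> nat) set" where
  "inv_join x y = (x \<union> y)\<^sup>+"

text \<open>Complementation in \<open>pairs n\<close> corresponds to reading a permutation backwards
  and reverses the order, so the meet is the De Morgan dual of the join. Unlike the join it depends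
  on \<open>n\<close>.\<close>

definition inv_meet :: "nat \<Rightarrow> (nat \<times> nat) set \<Rightarrow> (nat \<times> nat) set \<Rightarrow> (nat \<times> nat) set" where
  "inv_meet n x y = pairs n - inv_join (pairs n - x) (pairs n - y)"

definition inv_congruence :: "nat \<Rightarrow> ((nat \<times> nat) set \<times> (nat \<times> nat) set) set \<Rightarrow> bool" where
  "inv_congruence n R \<longleftrightarrow> equiv (inv_sets n) R \<and>
     (\<forall>x x' y y'. (x, x') \<in> R \<longrightarrow> (y, y') \<in> R \<longrightarrow>
        (inv_join x y, inv_join x' y') \<in> R \<and> (inv_meet n x y, inv_meet n x' y') \<in> R)"

lemma inv_setsI:
  assumes "\<And>a b. (a, b) \<in> I \<Longrightarrow> 1 \<le> b \<and> b < a \<and> a \<le> n"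
    and "\<And>a b c. (a, b) \<in> I \<Longrightarrow> (b, c) \<in> I \<Longrightarrow> (a, c) \<in> I"
    and "\<And>a b c. (a, c) \<in> I \<Longrightarrow> c < b \<Longrightarrow> b < a \<Longrightarrow> (a, b) \<in> I \<or> (b, c) \<in> I"
  shows "I \<in> inv_sets n"
proof -
  have "I \<subseteq> pairs n" using assms(1) by (auto simp: pairs_def)
  moreover have "trans I" using assms(2) by (rule transI)
  ultimately show ?thesis using assms(3) by (simp add: inv_sets_def)
qed

lemma inv_setsD:
  assumes "I \<in> inv_sets n"
  shows inv_sets_pairs: "(a, b) \<in> I \<Longrightarrow> 1 \<le> b \<and> b < a \<and> a \<le> n"
    and inv_sets_trans: "(a, b) \<in> I \<Longrightarrow> (b, c) \<in> I \<Longrightarrow> (a, c) \<in> I"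
    and inv_sets_cotrans: "(a, c) \<in> I \<Longrightarrow> c < b \<Longrightarrow> b < a \<Longrightarrow> (a, b) \<in> I \<or> (b, c) \<in> I"
proof -
  have "I \<subseteq> pairs n" "trans I" and
    co: "\<forall>a b c. (a, c) \<in> I \<longrightarrow> c < b \<longrightarrow> b < a \<longrightarrow> (a, b) \<in> I \<or> (b, c) \<in> I"
    using assms by (simp_all add: inv_sets_def)
  then show "(a, b) \<in> I \<Longrightarrow> 1 \<le> b \<and> b < a \<and> a \<le> n"
    by (auto simp: pairs_def)
  show "(a, b) \<in> I \<Longrightarrow> (b, c) \<in> I \<Longrightarrow> (a, c) \<in> I"
    using \<open>trans I\<close> by (rule transD)
  show "(a, c) \<in> I \<Longrightarrow> c < b \<Longrightarrow> b < a \<Longrightarrow> (a, b) \<in> I \<or> (b, c) \<in> I"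
    using co by simp
qed

lemma inv_sets_subset: "I \<in> inv_sets n \<Longrightarrow> I \<subseteq> pairs n"
  by (simp add: inv_sets_def)

lemma inv_sets_complement:
  assumes "I \<in> inv_sets n"
  shows "pairs n - I \<in> inv_sets n"
proof (rule inv_setsI)
  note I = inv_setsD[OF assms]
  fix a b c
  show "(a, b) \<in> pairs n - I \<Longrightarrow> 1 \<le> b \<and> b < a \<and> a \<le> n"
    by (auto simp: pairs_def)
  show "(a, b) \<in> pairs n - I \<Longrightarrow> (b, c) \<in> pairs n - I \<Longrightarrow> (a, c) \<in> pairs n - I"
    using I(3)[of a c b] by (auto simp: pairs_def)
  show "(a, c) \<in> pairs n - I \<Longrightarrow> c < b \<Longrightarrow> b < a \<Longrightarrow>
      (a, b) \<in> pairs n - I \<or> (b, c) \<in> pairs n - I"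
    using I(2)[of a b c] by (auto simp: pairs_def)
qed

text \<open>For cotransitivity, a value \<open>b\<close> between the ends of a descending chain
  either occurs in the chain or falls between two consecutive members. In the latter case
  cotransitivity of the set that supplies this link splits it at \<open>b\<close>.\<close>

lemma inv_join_in:
  assumes x: "x \<in> inv_sets n" and y: "y \<in> inv_sets n"
  shows "inv_join x y \<in> inv_sets n"
proof (rule inv_setsI)
  note xy = inv_setsD[OF x] inv_setsD[OF y]
  fix a b c
  show "1 \<le> b \<and> b < a \<and> a \<le> n" if "(a, b) \<in> inv_join x y"
    using that unfolding inv_join_def
  proof (induction rule: trancl_induct)
    case (base b)
    then show ?case using xy(1,4) by blast
  next
    case (step b c)
    from step(2) have "1 \<le> c \<and> c < b" using xy(1,4) by blast
    with step(3) show ?case by linarith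
  qed
  show "(a, c) \<in> inv_join x y" if "(a, b) \<in> inv_join x y" "(b, c) \<in> inv_join x y"
    using that unfolding inv_join_def by (rule trancl_trans)
  show "(a, b) \<in> inv_join x y \<or> (b, c) \<in> inv_join x y"
    if "(a, c) \<in> inv_join x y" "c < b" "b < a"
    using that unfolding inv_join_def
  proof (induction arbitrary: b rule: trancl_induct)
    case (base c)
    then show ?case using xy(3,6) by blast
  next
    case (step e c)
    consider "b < e" | "b = e" | "e < b" by linarith
    then show ?case
    proof cases
      case 1
      then have "(e, b) \<in> x \<union> y \<or> (b, c) \<in> x \<union> y" using xy(3,6) step by blast
      then show ?thesis using step.hyps(1) by (meson r_into_trancl trancl_into_trancl)
    next
      case 2
      then show ?thesis using step by blast
    next
      case 3
      then show ?thesis using step by (meson trancl_into_trancl)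
    qed
  qed
qed

lemma inv_join_ge: "x \<subseteq> inv_join x y" "y \<subseteq> inv_join x y"
  unfolding inv_join_def by auto

lemma inv_join_least:
  assumes "z \<in> inv_sets n" "x \<subseteq> z" "y \<subseteq> z"
  shows "inv_join x y \<subseteq> z"
proof -
  have "trans z" using assms(1) by (simp add: inv_sets_def)
  have "(x \<union> y)\<^sup>+ \<subseteq> z\<^sup>+" by (rule trancl_mono_subset) (rule Un_least[OF assms(2,3)])
  then show ?thesis unfolding inv_join_def trancl_id[OF \<open>trans z\<close>] .
qed

lemma inv_join_eqI:
  assumes "z \<in> inv_sets n" "x \<subseteq> z" "y \<subseteq> z" "z \<subseteq> inv_join x y"
  shows "inv_join x y = z"
  using inv_join_least[OF assms(1-3)] assms(4) by (rule subset_antisym)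

lemma inv_join_absorb: "y \<in> inv_sets n \<Longrightarrow> x \<subseteq> y \<Longrightarrow> inv_join x y = y"
  by (rule inv_join_eqI[OF _ _ subset_refl inv_join_ge(2)])

lemma inv_join_commute: "inv_join x y = inv_join y x"
  by (simp add: inv_join_def Un_commute)

lemma inv_meet_in: "x \<in> inv_sets n \<Longrightarrow> y \<in> inv_sets n \<Longrightarrow> inv_meet n x y \<in> inv_sets n"
  unfolding inv_meet_def by (intro inv_sets_complement inv_join_in)

lemma inv_meet_le:
  assumes "x \<in> inv_sets n" "y \<in> inv_sets n"
  shows "inv_meet n x y \<subseteq> x" "inv_meet n x y \<subseteq> y"
  using subsetD[OF inv_join_ge(1), of _ "pairs n - x" "pairs n - y"]
    subsetD[OF inv_join_ge(2), of _ "pairs n - y" "pairs n - x"]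
  by (auto simp: inv_meet_def)

lemma inv_meet_greatest:
  assumes "z \<in> inv_sets n" "z \<subseteq> x" "z \<subseteq> y"
  shows "z \<subseteq> inv_meet n x y"
proof
  fix p assume "p \<in> z"
  have "inv_join (pairs n - x) (pairs n - y) \<subseteq> pairs n - z"
    by (rule inv_join_least[OF inv_sets_complement[OF assms(1)]]) (rule Diff_mono[OF subset_refl], rule assms)+
  then show "p \<in> inv_meet n x y"
    using \<open>p \<in> z\<close> inv_sets_subset[OF assms(1)] by (auto simp: inv_meet_def)
qed

lemma inv_meet_eqI:
  assumes "x \<in> inv_sets n" "y \<in> inv_sets n" "z \<in> inv_sets n" "z \<subseteq> x" "z \<subseteq> y"
    "inv_meet n x y \<subseteq> z"
  shows "inv_meet n x y = z"
  using assms(6) inv_meet_greatest[OF assms(3-5)] by (rule subset_antisym)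

lemma inv_meet_absorb:
  "x \<in> inv_sets n \<Longrightarrow> y \<in> inv_sets n \<Longrightarrow> x \<subseteq> y \<Longrightarrow> inv_meet n x y = x"
  by (rule inv_meet_eqI[OF _ _ _ subset_refl _ inv_meet_le(1)])

locale congruence =
  fixes n :: nat and R :: "((nat \<times> nat) set \<times> (nat \<times> nat) set) set"
  assumes cong: "inv_congruence n R"
begin

abbreviation rel (infix "\<approx>" 50) where "x \<approx> y \<equiv> (x, y) \<in> R"

lemma equiv_rel: "equiv (inv_sets n) R"
  using cong by (simp add: inv_congruence_def)

lemma rel_refl [intro]: "x \<in> inv_sets n \<Longrightarrow> x \<approx> x"
  using equiv_rel by (auto simp: equiv_def refl_on_def)

lemma rel_sym: "x \<approx> y \<Longrightarrow> y \<approx> x"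
  using equiv_rel by (auto simp: equiv_def sym_def)

lemma rel_trans [trans]: "x \<approx> y \<Longrightarrow> y \<approx> z \<Longrightarrow> x \<approx> z"
  using equiv_rel by (meson equiv_def transE)

lemma rel_in: "x \<approx> y \<Longrightarrow> x \<in> inv_sets n \<and> y \<in> inv_sets n"
  using equiv_rel by (auto simp: equiv_def refl_on_def)

lemma rel_join: "x \<approx> x' \<Longrightarrow> y \<approx> y' \<Longrightarrow> inv_join x y \<approx> inv_join x' y'"
  using cong unfolding inv_congruence_def by blast

lemma rel_meet: "x \<approx> x' \<Longrightarrow> y \<approx> y' \<Longrightarrow> inv_meet n x y \<approx> inv_meet n x' y'"
  using cong unfolding inv_congruence_def by blast

text \<open>This is antisymmetry of the quotient order. It is applied below whenever inclusions and
  congruences close up to a cycle.\<close>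

lemma rel_antisym:
  assumes "u \<approx> u'" "v \<approx> v'" "u \<subseteq> v" "v' \<subseteq> u'"
  shows "u \<approx> v"
proof -
  have "v = inv_join u v" "inv_join u' v' = u'"
    using assms rel_in inv_join_absorb inv_join_commute by metis+
  then have "v \<approx> u'" using rel_join[OF assms(1,2)] by simp
  then show ?thesis using assms(1) rel_sym rel_trans by blast
qed

lemma rel_convex:
  assumes "x \<approx> z" "x \<subseteq> y" "y \<subseteq> z" "y \<in> inv_sets n"
  shows "x \<approx> y" "y \<approx> z"
  using assms rel_antisym[of x z y y] rel_refl[of y] rel_sym rel_trans by blast+

lemma rel_class: "x \<in> inv_sets n \<Longrightarrow> y \<in> inv_sets n \<Longrightarrow> R `` {x} = R `` {y} \<longleftrightarrow> x \<approx> y"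
  using equiv_rel by (simp add: eq_equiv_class_iff)

end

subsection \<open>Faces as intervals of inversion sets\<close>

text \<open>Entries with smaller \<open>c\<close> stand earlier. Hence \<open>lo\<close> and
  \<open>hi\<close> are the inversion sets of the permutations that write every block in increasing,
  respectively decreasing, order.\<close>

definition lo :: "nat \<Rightarrow> (nat \<Rightarrow> real) \<Rightarrow> (nat \<times> nat) set" where
  "lo n c = {(a, b). 1 \<le> b \<and> b < a \<and> a \<le> n \<and> c a < c b}"

definition hi :: "nat \<Rightarrow> (nat \<Rightarrow> real) \<Rightarrow> (nat \<times> nat) set" where
  "hi n c = {(a, b). 1 \<le> b \<and> b < a \<and> a \<le> n \<and> c a \<le> c b}"

text \<open>On inversion sets of size \<open>n\<close> this puts \<open>n + 1\<close> in front of
  the permutation.\<close>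

definition upper :: "nat \<Rightarrow> (nat \<times> nat) set \<Rightarrow> (nat \<times> nat) set" where
  "upper n x = x \<union> {Suc n} \<times> {1..n}"

lemma lo_in: "lo n c \<in> inv_sets n"
  by (rule inv_setsI) (auto simp: lo_def)

lemma hi_in: "hi n c \<in> inv_sets n"
  by (rule inv_setsI) (auto simp: hi_def)

lemma lo_subset_hi: "lo n c \<subseteq> hi n c"
  by (auto simp: lo_def hi_def)

lemma lo_upd [simp]: "lo n (c(Suc n := t)) = lo n c"
  by (auto simp: lo_def)

lemma hi_upd [simp]: "hi n (c(Suc n := t)) = hi n c"
  by (auto simp: hi_def)

lemma lo_Suc: "lo (Suc n) c = lo n c \<union> {Suc n} \<times> {b \<in> {1..n}. c (Suc n) < c b}"
  by (auto simp: lo_def less_Suc_eq_le le_Suc_eq)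

lemma hi_Suc: "hi (Suc n) c = hi n c \<union> {Suc n} \<times> {b \<in> {1..n}. c (Suc n) \<le> c b}"
  by (auto simp: hi_def less_Suc_eq_le le_Suc_eq)

text \<open>Reading the same set at size \<open>n + 1\<close> appends \<open>n + 1\<close> as the
  last entry.\<close>

lemma inv_sets_Suc: "x \<in> inv_sets n \<Longrightarrow> x \<in> inv_sets (Suc n)"
  unfolding inv_sets_def pairs_def by auto

lemma pairs_in: "pairs n \<in> inv_sets n"
  by (rule inv_setsI) (auto simp: pairs_def)

lemma empty_in: "{} \<in> inv_sets n"
  by (rule inv_setsI) auto

lemma restrict_in:
  assumes "x \<in> inv_sets (Suc n)"
  shows "x \<inter> pairs n \<in> inv_sets n"
proof (rule inv_setsI)
  note x = inv_setsD[OF assms]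
  fix a b c
  show "(a, b) \<in> x \<inter> pairs n \<Longrightarrow> 1 \<le> b \<and> b < a \<and> a \<le> n"
    by (auto simp: pairs_def)
  show "(a, b) \<in> x \<inter> pairs n \<Longrightarrow> (b, c) \<in> x \<inter> pairs n \<Longrightarrow> (a, c) \<in> x \<inter> pairs n"
    using x(2)[of a b c] by (auto simp: pairs_def)
  show "(a, c) \<in> x \<inter> pairs n \<Longrightarrow> c < b \<Longrightarrow> b < a \<Longrightarrow> (a, b) \<in> x \<inter> pairs n \<or> (b, c) \<in> x \<inter> pairs n"
    using x(3)[of a c b] by (auto simp: pairs_def)
qed

lemma upper_in:
  assumes "x \<in> inv_sets n"
  shows "upper n x \<in> inv_sets (Suc n)"
proof (rule inv_setsI)
  note x = inv_setsD[OF assms]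
  fix a b c
  show "(a, b) \<in> upper n x \<Longrightarrow> 1 \<le> b \<and> b < a \<and> a \<le> Suc n"
    using x(1)[of a b] by (auto simp: upper_def)
  show "(a, b) \<in> upper n x \<Longrightarrow> (b, c) \<in> upper n x \<Longrightarrow> (a, c) \<in> upper n x"
    using x(1)[of a b] x(1)[of b c] x(2)[of a b c] by (auto simp: upper_def)
  show "(a, c) \<in> upper n x \<Longrightarrow> c < b \<Longrightarrow> b < a \<Longrightarrow> (a, b) \<in> upper n x \<or> (b, c) \<in> upper n x"
    using x(3)[of a c b] by (auto simp: upper_def)
qed

lemma restrict_lo [simp]: "lo (Suc n) c \<inter> pairs n = lo n c"
  by (auto simp: lo_def pairs_def)

lemma restrict_hi [simp]: "hi (Suc n) c \<inter> pairs n = hi n c"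
  by (auto simp: hi_def pairs_def)

text \<open>\<open>pairs n\<close> belongs to the largest permutation that ends in
  \<open>n + 1\<close>. Moving \<open>n + 1\<close> to the end is thereby a lattice operation, which
  makes restriction compatible with congruences.\<close>

lemma meet_pairs:
  assumes "x \<in> inv_sets (Suc n)"
  shows "inv_meet (Suc n) x (pairs n) = x \<inter> pairs n"
proof (rule inv_meet_eqI)
  show "pairs n \<in> inv_sets (Suc n)" by (rule inv_sets_Suc[OF pairs_in])
  then show "inv_meet (Suc n) x (pairs n) \<subseteq> x \<inter> pairs n"
    by (intro Int_greatest inv_meet_le assms)
  show "x \<inter> pairs n \<in> inv_sets (Suc n)" by (rule inv_sets_Suc[OF restrict_in[OF assms]])
qed (use assms in simp_all)

text \<open>\<open>upper n {}\<close> belongs to \<open>n + 1\<close> followed by the other entries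
  in increasing order. Moving \<open>n + 1\<close> from the end to the front is thus compatible with
  congruences as well.\<close>

lemma join_upper:
  assumes "x \<in> inv_sets n"
  shows "inv_join x (upper n {}) = upper n x"
proof (rule inv_join_eqI[OF upper_in[OF assms]])
  have "upper n x = x \<union> upper n {}" by (simp add: upper_def)
  then show "upper n x \<subseteq> inv_join x (upper n {})"
    using Un_least[OF inv_join_ge] by simp
qed (auto simp: upper_def)

text \<open>The two sides take complements in different sets of pairs, so they are compared through
  the universal property of the meet.\<close>

lemma meet_Suc:
  assumes "x \<in> inv_sets n" "y \<in> inv_sets n"
  shows "inv_meet (Suc n) x y = inv_meet n x y"
proof -
  note xy = assms[THEN inv_sets_Suc]
  let ?m = "inv_meet (Suc n) x y"
  have m: "?m \<in> inv_sets (Suc n)" "?m \<subseteq> x" "?m \<subseteq> y"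
    using inv_meet_in[OF xy] inv_meet_le[OF xy] by auto
  have "?m \<inter> pairs n = ?m"
    using subset_trans[OF m(2) inv_sets_subset[OF assms(1)]] by (rule Int_absorb2)
  then have "?m \<in> inv_sets n"
    using restrict_in[OF m(1)] by simp
  then have "?m \<subseteq> inv_meet n x y" by (rule inv_meet_greatest[OF _ m(2,3)])
  moreover have "inv_meet n x y \<subseteq> ?m"
    by (rule inv_meet_greatest[OF inv_sets_Suc[OF inv_meet_in]]) (simp_all add: assms inv_meet_le)
  ultimately show ?thesis by (rule subset_antisym)
qed

section \<open>Restricting a congruence to the permutations that end in \<open>n + 1\<close>\<close>

locale congruence_Suc = congruence "Suc n" R for n R
begin

lemma congruence_restrict: "congruence n (R \<inter> inv_sets n \<times> inv_sets n)"
proof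
  let ?R = "R \<inter> inv_sets n \<times> inv_sets n"
  have "equiv (inv_sets n) ?R"
  proof (rule equivI)
    show "?R \<subseteq> inv_sets n \<times> inv_sets n" by blast
    show "refl_on (inv_sets n) ?R" by (auto simp: refl_on_def intro: rel_refl inv_sets_Suc)
    show "sym ?R" by (auto simp: sym_def intro: rel_sym)
    show "trans ?R" by (auto simp: trans_def intro: rel_trans)
  qed
  moreover have "(inv_join x y, inv_join x' y') \<in> ?R" "(inv_meet n x y, inv_meet n x' y') \<in> ?R"
    if "(x, x') \<in> ?R" "(y, y') \<in> ?R" for x x' y y'
    using that rel_join[of x x' y y'] rel_meet[of x x' y y']
    by (simp_all add: meet_Suc inv_join_in inv_meet_in)
  ultimately show "inv_congruence n ?R"
    unfolding inv_congruence_def by (intro conjI allI impI)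
qed

lemma rel_restrict:
  assumes "x \<approx> y"
  shows "x \<inter> pairs n \<approx> y \<inter> pairs n"
  using rel_meet[OF assms rel_refl[OF inv_sets_Suc[OF pairs_in]]] rel_in[OF assms]
  by (simp add: meet_pairs)

lemma rel_upper:
  assumes "x \<approx> y" "x \<in> inv_sets n" "y \<in> inv_sets n"
  shows "upper n x \<approx> upper n y"
  using rel_join[OF assms(1) rel_refl[OF upper_in[OF empty_in]]] assms(2,3)
  by (simp add: join_upper)

end

subsection \<open>Thin faces\<close>

definition separated :: "nat \<Rightarrow> (nat \<Rightarrow> real) \<Rightarrow> bool" where
  "separated n c \<longleftrightarrow> (\<forall>b\<in>{1..n}. c b \<noteq> c (Suc n))"

text \<open>The value \<open>t\<close> moves \<open>n + 1\<close> into a block of its own directly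
  behind its block in \<open>c\<close>; \<open>below\<close> moves it directly in front.\<close>

definition above :: "nat \<Rightarrow> (nat \<Rightarrow> real) \<Rightarrow> real \<Rightarrow> bool" where
  "above n c t \<longleftrightarrow> c (Suc n) < t \<and> (\<forall>b\<in>{1..n}. c b \<le> c (Suc n) \<or> t < c b)"

definition below :: "nat \<Rightarrow> (nat \<Rightarrow> real) \<Rightarrow> real \<Rightarrow> bool" where
  "below n c t \<longleftrightarrow> t < c (Suc n) \<and> (\<forall>b\<in>{1..n}. c b < t \<or> c (Suc n) \<le> c b)"

lemma finite_gap_above:
  fixes x :: real
  assumes "finite F"
  shows "\<exists>t>x. \<forall>y\<in>F. y \<le> x \<or> t < y"
  using assms
proof (induction F rule: finite_induct)
  case empty
  show ?case using gt_ex by auto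
next
  case (insert y F)
  then obtain t where t: "t > x" "\<forall>y\<in>F. y \<le> x \<or> t < y" by blast
  show ?case
  proof (cases "y \<le> x")
    case True
    with t show ?thesis by auto
  next
    case False
    then obtain u where "x < u" "u < y" using dense[of x y] by auto
    with t show ?thesis by (intro exI[of _ "min t u"]) auto
  qed
qed

lemma above_ex: "\<exists>t. above n c t"
  using finite_gap_above[of "c ` {1..n}" "c (Suc n)"] by (auto simp: above_def)

lemma below_ex: "\<exists>t. below n c t"
proof -
  obtain t where "t > - c (Suc n)" "\<forall>y\<in>(\<lambda>b. - c b) ` {1..n}. y \<le> - c (Suc n) \<or> t < y"
    using finite_gap_above[of "(\<lambda>b. - c b) ` {1..n}" "- c (Suc n)"] by auto
  then have "below n c (- t)" by (fastforce simp: below_def)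
  then show ?thesis ..
qed

text \<open>In the minimum, \<open>n + 1\<close> stands last in its block, being the largest entry,
  so leaving the block backwards does not change the minimum. In the maximum it stands first, whence
  the dual \<open>below_upd\<close>.\<close>

lemma above_upd:
  assumes "above n c t"
  shows "separated n (c(Suc n := t))" "lo (Suc n) (c(Suc n := t)) = lo (Suc n) c"
    "hi (Suc n) (c(Suc n := t)) \<subseteq> hi (Suc n) c"
  using assms by (force simp: above_def separated_def lo_Suc hi_Suc)+

lemma below_upd:
  assumes "below n c t"
  shows "separated n (c(Suc n := t))" "hi (Suc n) (c(Suc n := t)) = hi (Suc n) c"
    "lo (Suc n) c \<subseteq> lo (Suc n) (c(Suc n := t))"
  using assms by (force simp: below_def separated_def lo_Suc hi_Suc)+

lemma separated_hi: "separated n c \<Longrightarrow> hi (Suc n) c \<subseteq> lo (Suc n) c \<union> pairs n"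
  by (fastforce simp: separated_def lo_def hi_def pairs_def less_le le_Suc_eq)

text \<open>With \<open>n + 1\<close> alone in its block, minimum and maximum agree on the
  inversions of \<open>n + 1\<close>, and only the order of the other entries has to be
  changed.\<close>

lemma join_lo_hi:
  assumes "separated n c"
  shows "inv_join (lo (Suc n) c) (hi n c) = hi (Suc n) c"
proof (rule inv_join_eqI[OF hi_in lo_subset_hi])
  show "hi n c \<subseteq> hi (Suc n) c" by (auto simp: hi_Suc)
  have "hi (Suc n) c = lo (Suc n) c \<union> hi n c"
    using assms by (fastforce simp: separated_def lo_def hi_def less_le le_Suc_eq)
  then show "hi (Suc n) c \<subseteq> inv_join (lo (Suc n) c) (hi n c)"
    using Un_least[OF inv_join_ge] by simp
qed

text \<open>\<open>upper n (lo n c)\<close> restricts only the pairs without \<open>n + 1\<close>,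
  so the meet sorts the other entries and leaves \<open>n + 1\<close> between the same
  blocks.\<close>

lemma meet_hi_lo:
  assumes "separated n c"
  shows "inv_meet (Suc n) (hi (Suc n) c) (upper n (lo n c)) = lo (Suc n) c"
proof (rule inv_meet_eqI[OF hi_in upper_in[OF lo_in] lo_in lo_subset_hi])
  show "lo (Suc n) c \<subseteq> upper n (lo n c)" by (auto simp: lo_Suc upper_def)
  have "hi (Suc n) c \<inter> upper n (lo n c) \<subseteq> lo (Suc n) c"
    using assms by (fastforce simp: separated_def lo_def hi_def upper_def less_le)
  then show "inv_meet (Suc n) (hi (Suc n) c) (upper n (lo n c)) \<subseteq> lo (Suc n) c"
    using Int_greatest[OF inv_meet_le[OF hi_in upper_in[OF lo_in]]] by (rule subset_trans[rotated])
qed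

context congruence_Suc
begin

text \<open>A lift is thin if its classes correspond one to one to those of the face it lifts. The
  definition tests this at the maximum only: it must arise from the minimum by reordering the entries
  other than \<open>n + 1\<close>.\<close>

definition thin :: "(nat \<Rightarrow> real) \<Rightarrow> bool" where
  "thin c \<longleftrightarrow> inv_join (lo (Suc n) c) (hi n c) \<approx> hi (Suc n) c"

lemma rel_lo_restrict: "lo (Suc n) c \<approx> lo (Suc n) d \<Longrightarrow> lo n c \<approx> lo n d"
  using rel_restrict[of "lo (Suc n) c" "lo (Suc n) d"] by simp

lemma rel_hi_restrict: "hi (Suc n) c \<approx> hi (Suc n) d \<Longrightarrow> hi n c \<approx> hi n d"
  using rel_restrict[of "hi (Suc n) c" "hi (Suc n) d"] by simp

lemma thin_cong:
  assumes "lo (Suc n) c \<approx> lo (Suc n) d" "hi (Suc n) c \<approx> hi (Suc n) d"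
  shows "thin c \<longleftrightarrow> thin d"
proof -
  have "inv_join (lo (Suc n) c) (hi n c) \<approx> inv_join (lo (Suc n) d) (hi n d)"
    by (rule rel_join[OF assms(1) rel_hi_restrict[OF assms(2)]])
  then show ?thesis unfolding thin_def using assms(2) rel_trans rel_sym by metis
qed

lemma separated_thin: "separated n c \<Longrightarrow> thin c"
  unfolding thin_def by (simp only: join_lo_hi rel_refl hi_in)

text \<open>The join in \<open>thin\<close> is the maximum of the lift with \<open>n + 1\<close>
  directly behind the block, by \<open>join_lo_hi\<close>.\<close>

lemma thin_above:
  assumes "thin c" "above n c t"
  shows "hi (Suc n) (c(Suc n := t)) \<approx> hi (Suc n) c"
  using assms(1) join_lo_hi[OF above_upd(1)[OF assms(2)]]
  by (simp only: thin_def above_upd(2)[OF assms(2)] hi_upd)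

text \<open>Meeting the two congruent maxima of \<open>thin_above\<close> with
  \<open>upper n (lo n c)\<close> yields two congruent minima: those of the lifts with
  \<open>n + 1\<close> directly behind and directly in front of the block.\<close>

lemma thin_below:
  assumes "thin c" "below n c t"
  shows "lo (Suc n) (c(Suc n := t)) \<approx> lo (Suc n) c"
proof -
  obtain s where s: "above n c s" using above_ex by blast
  note a = above_upd[OF s] and b = below_upd[OF assms(2)]
  have "inv_meet (Suc n) (hi (Suc n) (c(Suc n := s))) (upper n (lo n c)) \<approx>
      inv_meet (Suc n) (hi (Suc n) c) (upper n (lo n c))"
    by (rule rel_meet[OF thin_above[OF assms(1) s]]) (intro rel_refl upper_in lo_in)
  then have "lo (Suc n) c \<approx> lo (Suc n) (c(Suc n := t))"
    using meet_hi_lo[OF a(1)] meet_hi_lo[OF b(1)] a(2) b(2) by simp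
  then show ?thesis by (rule rel_sym)
qed

text \<open>This reverses the passage of \<open>thin_below\<close>, so that thinness can also be
  recognised at the minimum.\<close>

lemma thin_dual:
  assumes "inv_meet (Suc n) (hi (Suc n) c) (upper n (lo n c)) \<approx> lo (Suc n) c"
  shows "thin c"
proof -
  obtain t where "below n c t" using below_ex by blast
  note b = below_upd[OF this]
  have "lo (Suc n) (c(Suc n := t)) \<approx> lo (Suc n) c"
    using assms meet_hi_lo[OF b(1)] b(2) by simp
  then have "inv_join (lo (Suc n) (c(Suc n := t))) (hi n c) \<approx> inv_join (lo (Suc n) c) (hi n c)"
    by (rule rel_join) (intro rel_refl inv_sets_Suc hi_in)
  then have "hi (Suc n) c \<approx> inv_join (lo (Suc n) c) (hi n c)"
    using join_lo_hi[OF b(1)] b(2) by simp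
  then show ?thesis unfolding thin_def by (rule rel_sym)
qed

text \<open>In a thin lift, \<open>n + 1\<close> can be pushed to the end of its block within the
  class, by meeting with the maximum of the lift directly behind the block. What remains is the
  order of the other entries.\<close>

lemma thin_rel:
  assumes "thin c" "z \<in> inv_sets (Suc n)" "lo (Suc n) c \<subseteq> z" "z \<subseteq> hi (Suc n) c"
  shows "z \<approx> inv_join (lo (Suc n) c) (z \<inter> pairs n)"
proof -
  obtain t where t: "above n c t" using above_ex by blast
  note a = above_upd[OF t]
  let ?h = "hi (Suc n) (c(Suc n := t))"
  define w where "w = inv_meet (Suc n) z ?h"
  have w: "w \<in> inv_sets (Suc n)" "w \<subseteq> ?h" "lo (Suc n) c \<subseteq> w"
    unfolding w_def using inv_meet_in[OF assms(2) hi_in] inv_meet_le[OF assms(2) hi_in]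
      inv_meet_greatest[OF lo_in assms(3)] a(2) lo_subset_hi by metis+
  have "w \<approx> inv_meet (Suc n) z (hi (Suc n) c)"
    unfolding w_def by (rule rel_meet[OF rel_refl[OF assms(2)] thin_above[OF assms(1) t]])
  then have wz: "w \<approx> z" using inv_meet_absorb[OF assms(2) hi_in assms(4)] by simp
  have "w \<subseteq> lo (Suc n) c \<union> pairs n"
    using w(2) separated_hi[OF a(1)] unfolding a(2) by (rule subset_trans)
  then have "w \<subseteq> lo (Suc n) c \<union> (w \<inter> pairs n)" by auto
  then have "inv_join (lo (Suc n) c) (w \<inter> pairs n) = w"
    using Un_least[OF inv_join_ge, of "lo (Suc n) c" "w \<inter> pairs n"]
    by (intro inv_join_eqI[OF w(1,3)]) auto
  moreover have "inv_join (lo (Suc n) c) (w \<inter> pairs n) \<approx> inv_join (lo (Suc n) c) (z \<inter> pairs n)"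
    by (rule rel_join[OF rel_refl[OF lo_in] rel_restrict[OF wz]])
  ultimately show ?thesis using wz rel_sym rel_trans by metis
qed

text \<open>By \<open>thin_rel\<close> in \<open>d\<close>, the maximum of \<open>c\<close> is
  already congruent to a join starting from the smaller minimum of \<open>d\<close>. The join that
  tests \<open>c\<close> lies between the two, and classes are convex.\<close>

lemma thin_mono:
  assumes "thin d" "lo (Suc n) d \<subseteq> lo (Suc n) c" "hi (Suc n) c \<subseteq> hi (Suc n) d"
  shows "thin c"
proof -
  have "lo (Suc n) d \<subseteq> hi (Suc n) c" using assms(2) lo_subset_hi by (rule subset_trans)
  from thin_rel[OF assms(1) hi_in this assms(3)]
  have *: "hi (Suc n) c \<approx> inv_join (lo (Suc n) d) (hi n c)" by simp
  have j: "inv_join (lo (Suc n) c) (hi n c) \<in> inv_sets (Suc n)"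
    by (intro inv_join_in lo_in inv_sets_Suc hi_in)
  have 1: "inv_join (lo (Suc n) d) (hi n c) \<subseteq> inv_join (lo (Suc n) c) (hi n c)"
    by (rule inv_join_least[OF j subset_trans[OF assms(2) inv_join_ge(1)] inv_join_ge(2)])
  have 2: "inv_join (lo (Suc n) c) (hi n c) \<subseteq> hi (Suc n) c"
    by (rule inv_join_least[OF hi_in lo_subset_hi]) (auto simp: hi_Suc)
  show ?thesis unfolding thin_def
    by (rule rel_convex(2)[OF rel_sym[OF *] 1 2 j])
qed

end

subsection \<open>Comparing faces over equivalent faces\<close>

lemma finite_argmin:
  fixes c :: "'a \<Rightarrow> 'b::linorder"
  assumes "finite B" "B \<noteq> {}"
  obtains b where "b \<in> B" "\<And>a. a \<in> B \<Longrightarrow> c b \<le> c a"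
proof -
  from ex_is_arg_min_if_finite[OF assms, of c] obtain b where "is_arg_min c (\<lambda>b. b \<in> B) b" ..
  with that show thesis by (auto simp: is_arg_min_linorder)
qed

lemma lo_antimono: "s \<le> t \<Longrightarrow> lo (Suc n) (c(Suc n := t)) \<subseteq> lo (Suc n) (c(Suc n := s))"
  unfolding lo_Suc by auto

lemma hi_antimono: "s \<le> t \<Longrightarrow> hi (Suc n) (c(Suc n := t)) \<subseteq> hi (Suc n) (c(Suc n := s))"
  unfolding hi_Suc by auto

lemma lo_subset_upper: "lo (Suc n) c \<subseteq> upper n (lo n c)"
  by (auto simp: lo_Suc upper_def)

lemma hi_subset: "hi n c \<subseteq> hi (Suc n) c"
  by (simp add: hi_Suc)

lemma lo_subset: "lo n c \<subseteq> lo (Suc n) c"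
  by (simp add: lo_Suc)

text \<open>An insertion has \<open>n + 1\<close> at the front of its block in the maximum, so it
  shares its maximum with the lift that has \<open>n + 1\<close> alone directly before that block.
  The second alternative is \<open>n + 1\<close> in last place.\<close>

lemma separated_next:
  assumes "separated n (c(Suc n := t))"
  shows "(\<exists>b\<in>{1..n}. t < c b \<and> hi (Suc n) (c(Suc n := c b)) = hi (Suc n) (c(Suc n := t))) \<or>
    hi (Suc n) (c(Suc n := t)) = hi n c"
proof (cases "\<exists>b\<in>{1..n}. t < c b")
  case True
  define B where "B = {b \<in> {1..n}. t < c b}"
  have "finite B" "B \<noteq> {}" using True by (auto simp: B_def)
  then obtain b where b: "b \<in> B" "\<And>a. a \<in> B \<Longrightarrow> c b \<le> c a"
    using finite_argmin[of B c] by metis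
  have "c b \<le> c a \<longleftrightarrow> t \<le> c a" if "a \<in> {1..n}" for a
    using b(1) b(2)[of a] that assms unfolding B_def separated_def by force
  then have "hi (Suc n) (c(Suc n := c b)) = hi (Suc n) (c(Suc n := t))"
    unfolding hi_Suc by auto
  with b(1) show ?thesis by (auto simp: B_def)
next
  case False
  then have "hi (Suc n) (c(Suc n := t)) = hi n c"
    using assms unfolding hi_Suc separated_def by force
  then show ?thesis ..
qed

context congruence_Suc
begin

text \<open>Every other entry \<open>b\<close> of the block is smaller than \<open>m\<close>, so
  cotransitivity can be used at \<open>m\<close>: if \<open>n + 1\<close> preceded \<open>b\<close>
  in the meet, then \<open>n + 1\<close> would precede \<open>m\<close>, against the choice of
  \<open>x\<close>, or \<open>m\<close> would precede \<open>b\<close>, against the increasing order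
  of the block.\<close>

lemma meet_subset_lo:
  assumes m: "m \<in> {1..n}" "\<And>b. b \<in> {1..n} \<Longrightarrow> d b = d (Suc n) \<Longrightarrow> b \<le> m" "d m = d (Suc n)"
    and x: "x \<in> inv_sets (Suc n)" "x \<subseteq> hi (Suc n) d" "(Suc n, m) \<notin> x"
  shows "inv_meet (Suc n) x (upper n (lo n d)) \<subseteq> lo (Suc n) d"
proof
  let ?m = "inv_meet (Suc n) x (upper n (lo n d))"
  note u = upper_in[OF lo_in, of n d]
  note le = inv_meet_le[OF x(1) u, THEN subsetD]
  fix p assume p: "p \<in> ?m"
  obtain a b where ab: "p = (a, b)" by (cases p)
  show "p \<in> lo (Suc n) d"
  proof (cases "a = Suc n")
    case False
    then show ?thesis using le(2)[OF p] ab by (auto simp: upper_def lo_Suc)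
  next
    case True
    have hi: "(Suc n, b) \<in> hi (Suc n) d" using le(1)[OF p] x(2) ab True by auto
    then have b: "b \<in> {1..n}" "d (Suc n) \<le> d b" by (auto simp: hi_def)
    have "d (Suc n) \<noteq> d b"
    proof
      assume eq: "d (Suc n) = d b"
      have "(Suc n, m) \<notin> ?m" using le(1) x(3) by auto
      moreover have "(m, b) \<notin> upper n (lo n d)" using eq m(1,3) by (auto simp: upper_def lo_def)
      then have "(m, b) \<notin> ?m" using le(2) by auto
      moreover have "b \<noteq> m" using p ab True calculation(1) by auto
      then have "b < m" using m(2)[OF b(1)] eq by simp
      ultimately show False
        using inv_sets_cotrans[OF inv_meet_in[OF x(1) u], of "Suc n" b m] p ab True m(1) by auto
    qed
    with b True ab show ?thesis by (auto simp: lo_Suc)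
  qed
qed

text \<open>In \<open>hi n d\<close> the entry \<open>m\<close> precedes all smaller entries of the
  block, so the single inversion of \<open>n + 1\<close> with \<open>m\<close> spreads over the
  block by transitivity.\<close>

lemma subset_join_hi:
  assumes m: "m \<in> {1..n}" "\<And>b. b \<in> {1..n} \<Longrightarrow> d b = d (Suc n) \<Longrightarrow> b \<le> m" "d m = d (Suc n)"
    and x: "lo (Suc n) d \<subseteq> x" "(Suc n, m) \<in> x"
  shows "hi (Suc n) d \<subseteq> inv_join x (hi n d)"
proof
  fix p assume p: "p \<in> hi (Suc n) d"
  obtain a b where ab: "p = (a, b)" by (cases p)
  have sub: "q \<in> inv_join x (hi n d)" if "q \<in> x \<or> q \<in> hi n d" for q
    using that subsetD[OF inv_join_ge(1)] subsetD[OF inv_join_ge(2)] by metis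
  show "p \<in> inv_join x (hi n d)"
  proof (cases "p \<in> x \<or> p \<in> hi n d")
    case True
    then show ?thesis by (rule sub)
  next
    case False
    then have b: "a = Suc n" "b \<in> {1..n}" "d (Suc n) \<le> d b" "p \<notin> lo (Suc n) d"
      using p ab x(1) by (auto simp: hi_Suc)
    then have eq: "d b = d (Suc n)" using ab by (auto simp: lo_Suc)
    have "b \<noteq> m" using False x(2) ab b(1) by auto
    then have "(m, b) \<in> hi n d" using m b(2) eq by (force simp: hi_def)
    then show ?thesis
      using sub[of "(Suc n, m)"] sub[of "(m, b)"] x(2) ab b(1)
      unfolding inv_join_def by (auto intro: trancl_trans)
  qed
qed

text \<open>The case distinction at \<open>m\<close>, the largest entry sharing the block of \<open>n + 1\<close> in \<open>d\<close>, works
  because joining with \<open>hi n d\<close> moves \<open>n + 1\<close> to the front of that block as soon as it precedes \<open>m\<close>,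
  while meeting with \<open>upper n (lo n d)\<close> moves it to the end of the block otherwise.\<close>

lemma strict_step:
  assumes sub: "lo (Suc n) d \<subseteq> lo (Suc n) c" "hi (Suc n) c \<subseteq> hi (Suc n) d"
    and base: "lo n c \<approx> lo n d" "hi n c \<approx> hi n d"
    and neq: "\<not> (lo (Suc n) c \<approx> lo (Suc n) d \<and> hi (Suc n) c \<approx> hi (Suc n) d)"
  shows "thin c \<and> \<not> thin d"
proof
  note refl = rel_refl[OF lo_in] rel_refl[OF hi_in]
  have sub3: "lo (Suc n) d \<subseteq> hi (Suc n) c" "lo (Suc n) c \<subseteq> hi (Suc n) d"
    using sub lo_subset_hi subset_trans by metis+
  show not_thin: "\<not> thin d"
  proof
    assume "thin d"
    \<comment> \<open>Inside a thin lift the bounds of \<open>c\<close> are determined up to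
      congruence by their restrictions, and these agree with the restrictions of the bounds of
      \<open>d\<close>.\<close>
    note tr = thin_rel[OF this]
    have "lo (Suc n) c \<approx> inv_join (lo (Suc n) d) (lo n c)"
      using tr[OF lo_in sub(1) sub3(2)] by simp
    moreover have "inv_join (lo (Suc n) d) (lo n c) \<approx> inv_join (lo (Suc n) d) (lo n d)"
      by (rule rel_join[OF refl(1) base(1)])
    moreover have "inv_join (lo (Suc n) d) (lo n d) = lo (Suc n) d"
      by (subst inv_join_commute) (rule inv_join_absorb[OF lo_in lo_subset])
    ultimately have 1: "lo (Suc n) c \<approx> lo (Suc n) d" using rel_trans by metis
    have "hi (Suc n) c \<approx> inv_join (lo (Suc n) d) (hi n c)"
      using tr[OF hi_in sub3(1) sub(2)] by simp
    moreover have "inv_join (lo (Suc n) d) (hi n c) \<approx> inv_join (lo (Suc n) d) (hi n d)"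
      by (rule rel_join[OF refl(1) base(2)])
    moreover have "inv_join (lo (Suc n) d) (hi n d) \<approx> hi (Suc n) d"
      using \<open>thin d\<close> by (simp add: thin_def)
    ultimately have "hi (Suc n) c \<approx> hi (Suc n) d" using rel_trans by metis
    with 1 neq show False by simp
  qed
  show "thin c"
  proof (rule ccontr)
    assume nt: "\<not> thin c"
    define B where "B = {b \<in> {1..n}. d b = d (Suc n)}"
    have "\<not> separated n d" using not_thin separated_thin[of d] by blast
    then have "finite B" "B \<noteq> {}" by (auto simp: B_def separated_def)
    then have "Max B \<in> B" "\<And>b. b \<in> B \<Longrightarrow> b \<le> Max B" by auto
    then obtain m where m: "m \<in> {1..n}" "\<And>b. b \<in> {1..n} \<Longrightarrow> d b = d (Suc n) \<Longrightarrow> b \<le> m"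
        "d m = d (Suc n)"
      unfolding B_def by blast
    note up = rel_upper[OF base(1) lo_in lo_in]
    show False
    proof (cases "(Suc n, m) \<in> lo (Suc n) c")
      case True
      have 1: "hi (Suc n) c \<subseteq> inv_join (lo (Suc n) c) (hi n d)"
        using subset_join_hi[OF m sub(1) True] sub(2) by (rule subset_trans[rotated])
      have 2: "inv_join (lo (Suc n) c) (hi n c) \<subseteq> hi (Suc n) c"
        by (rule inv_join_least[OF hi_in lo_subset_hi hi_subset])
      have 3: "inv_join (lo (Suc n) c) (hi n d) \<approx> inv_join (lo (Suc n) c) (hi n c)"
        by (rule rel_join[OF refl(1) rel_sym[OF base(2)]])
      \<comment> \<open>The maximum of \<open>c\<close> lies between two joins that are congruent
        because \<open>hi n c\<close> and \<open>hi n d\<close> are.\<close>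
      have "hi (Suc n) c \<approx> inv_join (lo (Suc n) c) (hi n d)"
        by (rule rel_antisym[OF refl(2) 3 1 2])
      then have "thin c" unfolding thin_def using 3 rel_sym rel_trans by metis
      with nt show False ..
    next
      case False
      have 1: "inv_meet (Suc n) (lo (Suc n) c) (upper n (lo n d)) \<subseteq> lo (Suc n) d"
        by (rule meet_subset_lo[OF m lo_in sub3(2) False])
      have "inv_meet (Suc n) (lo (Suc n) c) (upper n (lo n c)) = lo (Suc n) c"
        by (rule inv_meet_absorb[OF lo_in upper_in[OF lo_in] lo_subset_upper])
      then have "inv_meet (Suc n) (lo (Suc n) c) (upper n (lo n d)) \<approx> lo (Suc n) c"
        using rel_meet[OF refl(1)[of c] rel_sym[OF up]] by simp
      from rel_convex(2)[OF this 1 sub(1) lo_in] have lo: "lo (Suc n) c \<approx> lo (Suc n) d"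
        by (rule rel_sym)
      show False
      proof (cases "(Suc n, m) \<in> hi (Suc n) c")
        case True
        have "inv_join (hi (Suc n) c) (hi n d) = hi (Suc n) d"
          by (rule inv_join_eqI[OF hi_in sub(2) hi_subset subset_join_hi[OF m sub3(1) True]])
        moreover have "inv_join (hi (Suc n) c) (hi n c) = hi (Suc n) c"
          by (subst inv_join_commute) (rule inv_join_absorb[OF hi_in hi_subset])
        ultimately have "hi (Suc n) c \<approx> hi (Suc n) d"
          using rel_join[OF refl(2)[of c] base(2)] by simp
        with lo neq show False by simp
      next
        case False
        have 2: "inv_meet (Suc n) (hi (Suc n) c) (upper n (lo n d)) \<subseteq> lo (Suc n) c"
          using meet_subset_lo[OF m hi_in sub(2) False] sub(1) by (rule subset_trans)
        have 3: "lo (Suc n) c \<subseteq> inv_meet (Suc n) (hi (Suc n) c) (upper n (lo n c))"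
          by (rule inv_meet_greatest[OF lo_in lo_subset_hi lo_subset_upper])
        \<comment> \<open>Two congruent meets enclose the minimum of \<open>c\<close>; this is the
          criterion of \<open>thin_dual\<close>.\<close>
        have "inv_meet (Suc n) (hi (Suc n) c) (upper n (lo n d)) \<approx>
            inv_meet (Suc n) (hi (Suc n) c) (upper n (lo n c))"
          by (rule rel_meet[OF refl(2) rel_sym[OF up]])
        from rel_convex(2)[OF this 2 3 lo_in] have "thin c" by (intro thin_dual) (rule rel_sym)
        with nt show False ..
      qed
    qed
  qed
qed

text \<open>The minimum of the lift of \<open>d\<close> is moved, within its class, to a permutation over the minimum of
  \<open>c\<close>; moving \<open>n + 1\<close> there to the front of its block gives the lift of \<open>c\<close>.\<close>

lemma transport_separated:
  assumes base: "lo n c \<approx> lo n d" "hi n c \<approx> hi n d" and sep: "separated n d"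
  shows "\<exists>t. separated n (c(Suc n := t)) \<and> lo (Suc n) (c(Suc n := t)) \<approx> lo (Suc n) d \<and>
    hi (Suc n) (c(Suc n := t)) \<approx> hi (Suc n) d"
proof -
  note up = rel_upper[OF base(1) lo_in lo_in]
  have jin: "inv_join (lo (Suc n) d) (lo n c) \<in> inv_sets (Suc n)"
    by (intro inv_join_in lo_in inv_sets_Suc)
  \<comment> \<open>Join and meet force the smaller entries of \<open>z\<close> into the order of
    \<open>lo n c\<close>. The corresponding operations built from \<open>lo n d\<close> fix the
    minimum of \<open>d\<close>, so \<open>z\<close> is congruent to it.\<close>
  define z where "z = inv_meet (Suc n) (inv_join (lo (Suc n) d) (lo n c)) (upper n (lo n c))"
  have zin: "z \<in> inv_sets (Suc n)"
    unfolding z_def by (intro inv_meet_in jin upper_in lo_in)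
  have z_up: "z \<subseteq> upper n (lo n c)"
    unfolding z_def by (rule inv_meet_le(2)[OF jin upper_in[OF lo_in]])
  have z_lo: "lo n c \<subseteq> z"
    unfolding z_def
    by (rule inv_meet_greatest[OF inv_sets_Suc[OF lo_in] inv_join_ge(2)]) (simp add: upper_def)
  have "z \<approx> inv_meet (Suc n) (inv_join (lo (Suc n) d) (lo n d)) (upper n (lo n d))"
    unfolding z_def by (intro rel_meet rel_join rel_refl lo_in base up)
  moreover have "inv_join (lo (Suc n) d) (lo n d) = lo (Suc n) d"
    by (subst inv_join_commute) (rule inv_join_absorb[OF lo_in lo_subset])
  moreover have "inv_meet (Suc n) (lo (Suc n) d) (upper n (lo n d)) = lo (Suc n) d"
    by (rule inv_meet_absorb[OF lo_in upper_in[OF lo_in] lo_subset_upper])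
  ultimately have z: "z \<approx> lo (Suc n) d" by simp
  define E where "E = {b \<in> {1..n}. (Suc n, b) \<in> z}"
  have restr: "(a, b) \<in> z \<longleftrightarrow> (a, b) \<in> lo n c" if "a \<noteq> Suc n" for a b
    using that z_up z_lo by (auto simp: upper_def)
  \<comment> \<open>\<open>E\<close> is a final segment of the word of \<open>lo n c\<close>:
    whatever follows an entry behind \<open>n + 1\<close> is also behind
    \<open>n + 1\<close>.\<close>
  have E_up: "a \<in> E" if "b \<in> E" "a \<in> {1..n}" and ab: "c b < c a \<or> c b = c a \<and> b < a" for a b
  proof -
    consider "b < a" "c b \<le> c a" | "a < b" "c b < c a"
      using ab by (cases a b rule: linorder_cases) auto
    then show ?thesis
    proof cases
      case 1
      then have "(a, b) \<notin> z" using that(2) by (subst restr) (auto simp: lo_def)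
      then show ?thesis
        using inv_sets_cotrans[OF zin, of "Suc n" b a] that(1,2) 1 by (auto simp: E_def)
    next
      case 2
      then have "(b, a) \<in> z" using that(1,2) by (subst restr) (auto simp: lo_def E_def)
      then show ?thesis
        using inv_sets_trans[OF zin, of "Suc n" b a] that(1,2) by (auto simp: E_def)
    qed
  qed
  \<comment> \<open>The value \<open>t\<close> puts \<open>n + 1\<close> directly in front of the
    first block that meets \<open>E\<close>, or behind everything if \<open>E\<close> is
    empty.\<close>
  have "\<exists>t. separated n (c(Suc n := t)) \<and> (\<forall>a\<in>{1..n}. t \<le> c a \<longleftrightarrow> (\<exists>b\<in>E. c b \<le> c a))"
  proof (cases "E = {}")
    case True
    obtain t where "\<forall>x \<in> c ` {1..n}. x < t"
      using finite_imageI[of "{1..n}" c] by (metis Max_less_iff empty_iff finite_atLeastAtMost gt_ex)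
    with True show ?thesis by (intro exI[of _ t]) (force simp: separated_def)
  next
    case False
    moreover have "finite E" by (simp add: E_def)
    ultimately obtain b where b: "b \<in> E" "\<And>a. a \<in> E \<Longrightarrow> c b \<le> c a"
      using finite_argmin[of E c] by metis
    obtain t where t: "below n (c(Suc n := c b)) t" using below_ex by blast
    have "t \<le> c a \<longleftrightarrow> (\<exists>b\<in>E. c b \<le> c a)" if "a \<in> {1..n}" for a
      using t b that by (force simp: below_def)
    moreover have "separated n (c(Suc n := t))" using below_upd(1)[OF t] by simp
    ultimately show ?thesis by blast
  qed
  then obtain t where t: "separated n (c(Suc n := t))"
      "\<And>a. a \<in> {1..n} \<Longrightarrow> t \<le> c a \<longleftrightarrow> (\<exists>b\<in>E. c b \<le> c a)" by blast
  let ?c = "c(Suc n := t)"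
  have "inv_join z (hi n c) = hi (Suc n) ?c"
  proof (rule inv_join_eqI[OF hi_in])
    have "t \<le> c b" if "b \<in> E" for b
      using that t(2)[of b] by (auto simp: E_def)
    then have "{Suc n} \<times> E \<subseteq> hi (Suc n) ?c" unfolding hi_Suc E_def by auto
    moreover have "lo n c \<subseteq> hi (Suc n) ?c"
      using subset_trans[OF lo_subset_hi hi_subset[of n ?c]] by simp
    moreover have "z \<subseteq> lo n c \<union> {Suc n} \<times> E" using z_up by (auto simp: upper_def E_def)
    ultimately show "z \<subseteq> hi (Suc n) ?c" by (auto dest!: subsetD)
    show "hi n c \<subseteq> hi (Suc n) ?c" using hi_subset[of n ?c] by simp
    show "hi (Suc n) ?c \<subseteq> inv_join z (hi n c)"
    proof
      fix p assume p: "p \<in> hi (Suc n) ?c"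
      have sub: "q \<in> inv_join z (hi n c)" if "q \<in> z \<or> q \<in> hi n c" for q
        using that subsetD[OF inv_join_ge(1)] subsetD[OF inv_join_ge(2)] by metis
      show "p \<in> inv_join z (hi n c)"
      proof (cases "p \<in> hi n c")
        case False
        then obtain a where a: "p = (Suc n, a)" "a \<in> {1..n}" "t \<le> c a"
          using p unfolding hi_Suc by auto
        then obtain b where b: "b \<in> E" "c b \<le> c a" using t(2) by blast
        show ?thesis
        proof (cases "a \<in> E")
          case True
          then show ?thesis using a sub by (simp add: E_def)
        next
          case False
          \<comment> \<open>Only the block that \<open>n + 1\<close> splits in \<open>z\<close> is
            left. Its entries in front of \<open>n + 1\<close> are the smaller ones, and decreasing
            order puts \<open>b\<close> before them.\<close>
          then have "c b = c a" "a < b"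
            using E_up[OF b(1) a(2)] b by (cases a b rule: linorder_cases; force)+
          then have "(b, a) \<in> hi n c" "(Suc n, b) \<in> z" using a b by (auto simp: hi_def E_def)
          then show ?thesis using sub a(1) unfolding inv_join_def by (auto intro: trancl_trans)
        qed
      qed (use sub in simp)
    qed
  qed
  moreover have "inv_join z (hi n c) \<approx> inv_join (lo (Suc n) d) (hi n d)"
    by (rule rel_join[OF z base(2)])
  ultimately have hi: "hi (Suc n) ?c \<approx> hi (Suc n) d" using join_lo_hi[OF sep] by simp
  have "inv_meet (Suc n) (hi (Suc n) ?c) (upper n (lo n c)) \<approx>
      inv_meet (Suc n) (hi (Suc n) d) (upper n (lo n d))"
    by (rule rel_meet[OF hi up])
  then have "lo (Suc n) ?c \<approx> lo (Suc n) d"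
    using meet_hi_lo[OF t(1)] meet_hi_lo[OF sep] by simp
  with hi t(1) show ?thesis by blast
qed

end

subsection \<open>The path of faces over a face\<close>

text \<open>Keys name the equivalence classes of faces by classes of inversion sets;
  \<open>face_equiv_iff\<close> justifies this.\<close>

definition key :: "((nat \<times> nat) set \<times> (nat \<times> nat) set) set \<Rightarrow> nat \<Rightarrow> (nat \<Rightarrow> real) \<Rightarrow>
    (nat \<times> nat) set set \<times> (nat \<times> nat) set set" where
  "key R n c = (R `` {lo n c}, R `` {hi n c})"

text \<open>\<open>rk\<close> stands for the dimension. It is a parameter because it is built along
  the recursion; once it is strictly monotone on classes, linked classes form a cover.\<close>

definition linked :: "((nat \<times> nat) set \<times> (nat \<times> nat) set) set \<Rightarrow> nat \<Rightarrow> ((nat \<Rightarrow> real) \<Rightarrow> nat) \<Rightarrow>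
    (nat \<times> nat) set set \<times> (nat \<times> nat) set set \<Rightarrow> (nat \<times> nat) set set \<times> (nat \<times> nat) set set \<Rightarrow> bool" where
  "linked R n rk k k' \<longleftrightarrow> (\<exists>c d. k = key R n c \<and> k' = key R n d \<and>
     lo n d \<subseteq> lo n c \<and> hi n c \<subseteq> hi n d \<and> rk d = Suc (rk c))"

definition adj :: "((nat \<times> nat) set \<times> (nat \<times> nat) set) set \<Rightarrow> nat \<Rightarrow> ((nat \<Rightarrow> real) \<Rightarrow> nat) \<Rightarrow>
    (nat \<times> nat) set set \<times> (nat \<times> nat) set set \<Rightarrow> (nat \<times> nat) set set \<times> (nat \<times> nat) set set \<Rightarrow> bool" where
  "adj R n rk k k' \<longleftrightarrow> linked R n rk k k' \<or> linked R n rk k' k"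

lemma (in congruence) key_eq: "key R n c = key R n d \<longleftrightarrow> lo n c \<approx> lo n d \<and> hi n c \<approx> hi n d"
  by (simp add: key_def rel_class lo_in hi_in)

context congruence_Suc
begin

text \<open>The separated neighbours of the lift of \<open>d\<close> can be transported, but they
  control its minimum and its maximum by different values. A common value is the largest block value
  of \<open>c\<close> whose insertion has the right maximum.\<close>

lemma transport:
  assumes base: "lo n c \<approx> lo n d" "hi n c \<approx> hi n d"
  shows "\<exists>t. lo (Suc n) (c(Suc n := t)) \<approx> lo (Suc n) d \<and> hi (Suc n) (c(Suc n := t)) \<approx> hi (Suc n) d"
proof (cases "separated n d")
  case True
  then show ?thesis using transport_separated[OF base] by blast
next
  case nsep: False
  obtain ta tb where tab: "above n d ta" "below n d tb" using above_ex below_ex by metis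
  let ?L = "\<lambda>c t. lo (Suc n) (c(Suc n := t))" and ?H = "\<lambda>c t. hi (Suc n) (c(Suc n := t))"
  note a = above_upd[OF tab(1)] and b = below_upd[OF tab(2)]
  have base': "lo n c \<approx> lo n (d(Suc n := t))" "hi n c \<approx> hi n (d(Suc n := t))" for t
    using base by simp_all
  obtain t1 where t1: "separated n (c(Suc n := t1))" "?L c t1 \<approx> lo (Suc n) d" "?H c t1 \<approx> ?H d ta"
    using transport_separated[OF base' a(1)] unfolding a(2) by blast
  obtain t2 where t2: "separated n (c(Suc n := t2))" "?H c t2 \<approx> hi (Suc n) d"
    using transport_separated[OF base' b(1)] unfolding b(2) by blast
  show ?thesis
  proof (cases "?H d ta \<approx> hi (Suc n) d")
    case True
    then show ?thesis using t1(2,3) rel_trans by blast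
  next
    case False
    \<comment> \<open>The maximum of \<open>d\<close> is not congruent to that of its neighbour
      behind, so its class contains nothing below \<open>?H c t1\<close>.\<close>
    have no_low: False if "s \<in> inv_sets (Suc n)" "s \<approx> hi (Suc n) d" "s \<subseteq> ?H c t1" for s
    proof -
      have "s \<approx> ?H c t1" by (rule rel_antisym[OF that(2) t1(3) that(3) a(3)])
      then show False using that(2) t1(3) False rel_sym rel_trans by metis
    qed
    have bottom: "hi n c \<subseteq> ?H c t1" using hi_subset[of n "c(Suc n := t1)"] by simp
    \<comment> \<open>\<open>S\<close> is nonempty because the lift at \<open>t2\<close> shares its
      maximum with the insertion into the next block, and a next block exists by
      \<open>no_low\<close>.\<close>
    define S where "S = {b \<in> {1..n}. ?H c (c b) \<approx> hi (Suc n) d}"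
    have "S \<noteq> {}"
      using separated_next[OF t2(1)] t2(2) no_low[OF hi_in t2(2)] bottom unfolding S_def by force
    moreover have "finite S" by (simp add: S_def)
    ultimately obtain m where m: "m \<in> S" "\<And>b. b \<in> S \<Longrightarrow> c b \<le> c m"
      using finite_argmin[of S "\<lambda>b. - c b"] by (metis neg_le_iff_le)
    then have hm: "?H c (c m) \<approx> hi (Suc n) d" and mn: "m \<in> {1..n}" by (auto simp: S_def)
    obtain ts where ts: "above n (c(Suc n := c m)) ts" using above_ex by blast
    have ts': "separated n (c(Suc n := ts))" "?L c ts = ?L c (c m)" "?H c ts \<subseteq> ?H c (c m)" "c m < ts"
      using above_upd[OF ts] ts by (simp_all add: above_def)
    have base_c: "lo n d \<approx> lo n (c(Suc n := ts))" "hi n d \<approx> hi n (c(Suc n := ts))"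
      using base rel_sym by simp_all
    \<comment> \<open>The insertion at \<open>c m\<close> and the lift directly behind it have the
      same minimum, so the latter is transported back to \<open>d\<close> and located relative to
      the block there.\<close>
    obtain u where u: "separated n (d(Suc n := u))" "?L d u \<approx> ?L c ts" "?H d u \<approx> ?H c ts"
      using transport_separated[OF base_c ts'(1)] by blast
    have "u \<noteq> d (Suc n)" using nsep u(1) by (auto simp: separated_def)
    then consider "u < d (Suc n)" | "d (Suc n) < u" by linarith
    then show ?thesis
    proof cases
      case 1
      \<comment> \<open>Here the lift at \<open>ts\<close> already has the right maximum, which it
        shares with a block behind \<open>m\<close> or with \<open>hi n c\<close>. Maximality of
        \<open>m\<close> excludes the former, \<open>no_low\<close> the latter.\<close>
      then have "hi (Suc n) d \<subseteq> ?H d u" using hi_antimono[of u "d (Suc n)" n d] by simp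
      from rel_antisym[OF rel_sym[OF hm] u(3) this ts'(3)]
      have h: "?H c ts \<approx> hi (Suc n) d" using u(3) rel_sym rel_trans by metis
      have "b \<notin> S" if "ts < c b" for b using m(2)[of b] that ts'(4) by auto
      then have "?H c ts = hi n c"
        using separated_next[OF ts'(1)] h unfolding S_def by force
      then show ?thesis using no_low[OF hi_in h] bottom by simp
    next
      case 2
      \<comment> \<open>Now the minima close up to a cycle: \<open>lo (Suc n) d\<close> is congruent
        to \<open>?L c t1\<close>, which lies below \<open>?L c ts\<close>, which is congruent to
        \<open>?L d u\<close>, which lies below \<open>lo (Suc n) d\<close>.\<close>
      then have low: "?L d u \<subseteq> lo (Suc n) d" using lo_antimono[of "d (Suc n)" u n d] by simp
      have "t1 \<noteq> c m" using t1(1) mn by (auto simp: separated_def)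
      moreover have "\<not> t1 < c m"
        using no_low[OF hi_in hm] hi_antimono[of t1 "c m" n c] by auto
      ultimately have "?L c t1 \<subseteq> ?L c ts" using lo_antimono[of "c m" t1 n c] ts'(2) by simp
      from rel_antisym[OF t1(2) rel_sym[OF u(2)] this low]
      have "?L c (c m) \<approx> lo (Suc n) d" using t1(2) ts'(2) rel_sym rel_trans by metis
      with hm show ?thesis by blast
    qed
  qed
qed

abbreviation K where "K \<equiv> key R (Suc n)"

lemma K_eq: "K c = K d \<longleftrightarrow> lo (Suc n) c \<approx> lo (Suc n) d \<and> hi (Suc n) c \<approx> hi (Suc n) d"
  by (rule key_eq)

text \<open>Both bounds grow as the value of \<open>n + 1\<close> decreases, and congruence classes
  are convex. Hence a key never returns once it has been left.\<close>

lemma K_convex: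
  assumes "s \<le> u" "u \<le> t" "K (c(Suc n := s)) = K (c(Suc n := t))"
  shows "K (c(Suc n := u)) = K (c(Suc n := t))"
proof -
  have "lo (Suc n) (c(Suc n := t)) \<approx> lo (Suc n) (c(Suc n := s))"
    "hi (Suc n) (c(Suc n := t)) \<approx> hi (Suc n) (c(Suc n := s))"
    using assms(3) unfolding K_eq by (simp_all add: rel_sym)
  from rel_convex(1)[OF this(1) lo_antimono[OF assms(2)] lo_antimono[OF assms(1)] lo_in]
    rel_convex(1)[OF this(2) hi_antimono[OF assms(2)] hi_antimono[OF assms(1)] hi_in]
  show ?thesis unfolding K_eq by (simp add: rel_sym)
qed

lemma K_gap:
  assumes "s \<le> t" "\<And>b. b \<in> {1..n} \<Longrightarrow> c b < s \<or> t < c b"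
  shows "K (c(Suc n := s)) = K (c(Suc n := t))"
proof -
  have "s \<le> c b \<longleftrightarrow> t \<le> c b" "s < c b \<longleftrightarrow> t < c b" if "b \<in> {1..n}" for b
    using assms(1) assms(2)[OF that] by auto
  then have "lo (Suc n) (c(Suc n := s)) = lo (Suc n) (c(Suc n := t))"
      "hi (Suc n) (c(Suc n := s)) = hi (Suc n) (c(Suc n := t))"
    unfolding lo_Suc hi_Suc by auto
  then show ?thesis by (simp add: key_def)
qed

text \<open>The induction is on the number of entries in front of \<open>n + 1\<close>. One step
  passes the last block in front of it, through the insertion \<open>e\<close>, to the singleton
  position at \<open>t1\<close>.\<close>

lemma descending_path:
  fixes rk :: "(nat \<Rightarrow> real) \<Rightarrow> nat"
  defines "rank \<equiv> \<lambda>c. rk c + (if thin c then 0 else 1)"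
  assumes rk: "\<And>t. rk (c(Suc n := t)) = rk c"
    and "separated n (c(Suc n := t))"
  shows "\<exists>ks. ks \<noteq> [] \<and> hd ks = K (c(Suc n := t)) \<and>
    (\<forall>s. (\<forall>b\<in>{1..n}. s < c b) \<longrightarrow> last ks = K (c(Suc n := s))) \<and> distinct ks \<and>
    successively (adj R (Suc n) rank) ks \<and> set ks = {K (c(Suc n := s)) | s. s \<le> t}"
  using assms(3)
proof (induction "card {b \<in> {1..n}. c b < t}" arbitrary: t rule: less_induct)
  case less
  have sep: "c b \<noteq> t" if "b \<in> {1..n}" for b
    using less.prems that by (auto simp: separated_def)
  show ?case
  proof (cases "\<exists>b\<in>{1..n}. c b < t")
    case False
    then have gt: "t < c b" if "b \<in> {1..n}" for b using sep that by force
    have const: "K (c(Suc n := s)) = K (c(Suc n := t))" if "s \<le> t \<or> (\<forall>b\<in>{1..n}. s < c b)" for s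
    proof (cases "s \<le> t")
      case True
      then show ?thesis by (rule K_gap) (simp add: gt)
    next
      case False
      with that show ?thesis by (intro K_gap[symmetric]) auto
    qed
    have "{K (c(Suc n := s)) | s. s \<le> t} = {K (c(Suc n := t))}"
    proof (intro equalityI subsetI)
      fix k assume "k \<in> {K (c(Suc n := s)) | s. s \<le> t}"
      then obtain s where "k = K (c(Suc n := s))" "s \<le> t" by auto
      with const[of s] show "k \<in> {K (c(Suc n := t))}" by simp
    qed auto
    moreover have "\<forall>s. (\<forall>b\<in>{1..n}. s < c b) \<longrightarrow> K (c(Suc n := t)) = K (c(Suc n := s))"
      by (intro allI impI const[symmetric]) (rule disjI2)
    ultimately show ?thesis by (intro exI[of _ "[K (c(Suc n := t))]"]) simp
  next
    case True
    define B where "B = {b \<in> {1..n}. c b < t}"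
    have "finite B" "B \<noteq> {}" using True by (auto simp: B_def)
    then obtain m where m: "m \<in> B" "\<And>b. b \<in> B \<Longrightarrow> c b \<le> c m"
      using finite_argmin[of B "\<lambda>b. - c b"] by (metis neg_le_iff_le)
    define e where "e = c(Suc n := c m)"
    have e_upd: "e(Suc n := s) = c(Suc n := s)" for s by (simp add: e_def)
    have ab: "above n e t"
      using m sep by (force simp: above_def e_def B_def)
    obtain t1 where be: "below n e t1" using below_ex by blast
    have a: "lo (Suc n) (c(Suc n := t)) = lo (Suc n) e" "hi (Suc n) (c(Suc n := t)) \<subseteq> hi (Suc n) e"
      using above_upd[OF ab] by (simp_all add: e_upd)
    have b: "separated n (c(Suc n := t1))" "hi (Suc n) (c(Suc n := t1)) = hi (Suc n) e"
      "lo (Suc n) e \<subseteq> lo (Suc n) (c(Suc n := t1))"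
      using below_upd[OF be] by (simp_all add: e_upd)
    have lt: "t1 < c m" "c m < t" using be ab by (simp_all add: below_def above_def e_def)
    have "{b \<in> {1..n}. c b < t1} \<subseteq> B" "m \<notin> {b \<in> {1..n}. c b < t1}"
      using lt by (auto simp: B_def)
    with m(1) have "{b \<in> {1..n}. c b < t1} \<subset> B" by blast
    then have "card {b \<in> {1..n}. c b < t1} < card {b \<in> {1..n}. c b < t}"
      using \<open>finite B\<close> unfolding B_def by (rule psubset_card_mono[rotated])
    from less.hyps[OF this b(1)] obtain ks where ks: "ks \<noteq> []" "hd ks = K (c(Suc n := t1))"
      "\<forall>s. (\<forall>b\<in>{1..n}. s < c b) \<longrightarrow> last ks = K (c(Suc n := s))" "distinct ks"
      "successively (adj R (Suc n) rank) ks" "set ks = {K (c(Suc n := s)) | s. s \<le> t1}" by blast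
    have split: "K (c(Suc n := s)) = K (c(Suc n := t)) \<or> K (c(Suc n := s)) = K e \<or>
        K (c(Suc n := s)) = K (c(Suc n := t1)) \<or> s \<le> t1" if "s \<le> t" for s
    proof -
      consider "c m < s" | "s = c m" | "t1 < s" "s < c m" | "s \<le> t1" by linarith
      then show ?thesis
      proof cases
        case 1
        have "K (c(Suc n := s)) = K (c(Suc n := t))"
          by (rule K_gap[OF that]) (use ab 1 in \<open>force simp: above_def e_def\<close>)
        then show ?thesis ..
      next
        case 3
        have "K (c(Suc n := t1)) = K (c(Suc n := s))"
          by (rule K_gap) (use be 3 in \<open>force simp: below_def e_def\<close>)+
        then show ?thesis by simp
      qed (simp_all add: e_def)
    qed
    have t1_in: "K (c(Suc n := t1)) \<in> set ks" using ks(1,2) hd_in_set by metis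
    have "{K (c(Suc n := s)) | s. s \<le> t} \<subseteq> {K (c(Suc n := t)), K e} \<union> set ks"
      using split t1_in unfolding ks(6) by fastforce
    moreover have "set ks \<subseteq> {K (c(Suc n := s)) | s. s \<le> t}" unfolding ks(6) using lt by force
    moreover have "K (c(Suc n := t)) \<in> {K (c(Suc n := s)) | s. s \<le> t}"
      "K e \<in> {K (c(Suc n := s)) | s. s \<le> t}" using lt by (auto simp: e_def intro: less_imp_le)
    ultimately have set: "{K (c(Suc n := s)) | s. s \<le> t} = {K (c(Suc n := t)), K e} \<union> set ks" by blast
    show ?thesis
    proof (cases "thin e")
      case True
      have "K (c(Suc n := t)) = K e" "K (c(Suc n := t1)) = K e"
        using thin_above[OF True ab] thin_below[OF True be]
        by (simp_all add: K_eq e_upd a b rel_refl lo_in hi_in)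
      then show ?thesis using ks t1_in set by (intro exI[of _ ks]) auto
    next
      case False
      have thins: "thin (c(Suc n := t))" "thin (c(Suc n := t1))"
        using less.prems b(1) separated_thin by auto
      then have ne: "K (c(Suc n := t)) \<noteq> K e" "K (c(Suc n := t1)) \<noteq> K e"
        using False thin_cong unfolding K_eq by blast+
      have ranks: "rank e = Suc (rank (c(Suc n := t)))" "rank e = Suc (rank (c(Suc n := t1)))"
        using rk thins False by (simp_all add: rank_def e_def)
      have "linked R (Suc n) rank (K (c(Suc n := t))) (K e)"
        unfolding linked_def using a ranks by (intro exI conjI) (rule refl, rule refl, simp_all)
      moreover have "linked R (Suc n) rank (K (c(Suc n := t1))) (K e)"
        unfolding linked_def using b ranks by (intro exI conjI) (rule refl, rule refl, simp_all)
      ultimately have adjs: "adj R (Suc n) rank (K (c(Suc n := t))) (K e)"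
        "adj R (Suc n) rank (K e) (hd ks)" unfolding adj_def ks(2) by blast+
      \<comment> \<open>By convexity, a repetition would identify two neighbouring keys that were
        just shown to differ.\<close>
      have "K e \<notin> set ks"
      proof
        assume "K e \<in> set ks"
        then obtain s where "s \<le> t1" "K (c(Suc n := s)) = K e" unfolding ks(6) by auto
        then show False using K_convex[of s t1 "c m" c] lt(1) ne(2) by (simp add: e_def)
      qed
      moreover have "K (c(Suc n := t)) \<notin> set ks"
      proof
        assume "K (c(Suc n := t)) \<in> set ks"
        then obtain s where "s \<le> t1" "K (c(Suc n := s)) = K (c(Suc n := t))" unfolding ks(6) by auto
        then show False using K_convex[of s "c m" t c] lt ne(1) by (simp add: e_def)
      qed
      moreover have "successively (adj R (Suc n) rank) (K (c(Suc n := t)) # K e # ks)"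
        using adjs ks(1,5) by (cases ks) auto
      ultimately show ?thesis
        using ks(1,3,4) ne set
        by (intro exI[of _ "K (c(Suc n := t)) # K e # ks"]) auto
    qed
  qed
qed

end

subsection \<open>Zigzagging through the fibres\<close>

lemma lift_top:
  assumes "\<forall>b\<in>{1..n}. c b < t"
  shows "lo (Suc n) (c(Suc n := t)) = lo n c" "hi (Suc n) (c(Suc n := t)) = hi n c"
proof -
  have "\<not> t < c b" "\<not> t \<le> c b" if "b \<in> {1..n}" for b
    using bspec[OF assms that] by simp_all
  then show "lo (Suc n) (c(Suc n := t)) = lo n c" "hi (Suc n) (c(Suc n := t)) = hi n c"
    by (auto simp: lo_Suc hi_Suc)
qed

lemma lift_bottom:
  assumes "\<forall>b\<in>{1..n}. t < c b"
  shows "lo (Suc n) (c(Suc n := t)) = upper n (lo n c)" "hi (Suc n) (c(Suc n := t)) = upper n (hi n c)"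
proof -
  have "t < c b" "t \<le> c b" if "b \<in> {1..n}" for b
    using bspec[OF assms that] by simp_all
  then show "lo (Suc n) (c(Suc n := t)) = upper n (lo n c)" "hi (Suc n) (c(Suc n := t)) = upper n (hi n c)"
    by (auto simp: lo_Suc hi_Suc upper_def)
qed

lemma ex_upper_bound: "\<exists>t::real. \<forall>b\<in>{1..n::nat}. c b < t"
proof (induction n)
  case (Suc n)
  then obtain t where "\<forall>b\<in>{1..n}. c b < t" by blast
  then have "\<forall>b\<in>{1..Suc n}. c b < max t (c (Suc n) + 1)"
    by (auto simp: le_Suc_eq less_max_iff_disj)
  then show ?case ..
qed simp

lemma ex_lower_bound: "\<exists>t::real. \<forall>b\<in>{1..n::nat}. t < c b"
proof -
  obtain t where "\<forall>b\<in>{1..n}. - c b < t" using ex_upper_bound[of n "\<lambda>b. - c b"] by blast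
  then show ?thesis by (intro exI[of _ "- t"]) (simp add: minus_less_iff)
qed

fun zigzag :: "('k \<Rightarrow> 'a list) \<Rightarrow> bool \<Rightarrow> 'k list \<Rightarrow> 'a list" where
  "zigzag P up [] = []"
| "zigzag P up (k # ks) = (if up then P k else rev (P k)) @ zigzag P (\<not> up) ks"

lemma set_zigzag: "set (zigzag P up ks) = (\<Union>k\<in>set ks. set (P k))"
  by (induction P up ks rule: zigzag.induct) auto

lemma distinct_zigzag:
  assumes "distinct ks" "\<And>k. k \<in> set ks \<Longrightarrow> distinct (P k)"
    "\<And>k k'. k \<in> set ks \<Longrightarrow> k' \<in> set ks \<Longrightarrow> k \<noteq> k' \<Longrightarrow> set (P k) \<inter> set (P k') = {}"
  shows "distinct (zigzag P up ks)"
  using assms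
proof (induction P up ks rule: zigzag.induct)
  case (2 P up k ks)
  have "set (P k) \<inter> (\<Union>k'\<in>set ks. set (P k')) = {}"
    using "2.prems"(1) "2.prems"(3)[of k] by fastforce
  moreover have "distinct (zigzag P (\<not> up) ks)" using 2 by simp
  ultimately show ?case using "2.prems"(2)[of k] by (simp add: set_zigzag)
qed simp

text \<open>The end at which the list stops depends on the parity of the number of fibres. Two
  candidates suffice, since both ends over a face of rank 0 have rank 0.\<close>

lemma zigzag_ends:
  assumes "ks \<noteq> []" "\<And>k. k \<in> set ks \<Longrightarrow> P k \<noteq> []"
  shows "zigzag P up ks \<noteq> []"
    and "hd (zigzag P up ks) = (if up then hd (P (hd ks)) else last (P (hd ks)))"
    and "last (zigzag P up ks) \<in> {hd (P (last ks)), last (P (last ks))}"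
proof -
  show "zigzag P up ks \<noteq> []"
    using assms by (cases ks) auto
  show "hd (zigzag P up ks) = (if up then hd (P (hd ks)) else last (P (hd ks)))"
    using assms by (cases ks) (auto simp: hd_rev)
  show "last (zigzag P up ks) \<in> {hd (P (last ks)), last (P (last ks))}"
    using assms
  proof (induction P up ks rule: zigzag.induct)
    case (2 P up k ks)
    show ?case
    proof (cases "ks = []")
      case True
      with "2.prems"(2) show ?thesis by (auto simp: last_rev)
    next
      case False
      then have "zigzag P (\<not> up) ks \<noteq> []" using "2.prems"(2) by (cases ks) auto
      with 2 False show ?thesis by simp
    qed
  qed simp
qed

text \<open>Consecutive fibres are joined alternately at their last and at their first entries, so
  both ends have to match. Symmetry of \<open>B\<close> allows reversing a path.\<close>

lemma successively_zigzag:
  assumes "successively A ks" "\<And>k. k \<in> set ks \<Longrightarrow> P k \<noteq> []" "\<And>k. k \<in> set ks \<Longrightarrow> successively B (P k)"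
    and "\<And>x y. B x y \<Longrightarrow> B y x"
    and "\<And>k k'. k \<in> set ks \<Longrightarrow> k' \<in> set ks \<Longrightarrow> A k k' \<Longrightarrow> B (hd (P k)) (hd (P k')) \<and> B (last (P k)) (last (P k'))"
  shows "successively B (zigzag P up ks)"
  using assms
proof (induction P up ks rule: zigzag.induct)
  case (2 P up k ks)
  have "successively B (rev (P k))"
    unfolding successively_rev
    by (rule successively_mono[OF "2.prems"(3)]) (simp_all add: "2.prems"(4))
  then have first: "successively B (if up then P k else rev (P k))"
    using "2.prems"(3)[of k] by simp
  show ?case
  proof (cases "ks = []")
    case True
    with first show ?thesis by simp
  next
    case False
    then have "A k (hd ks)" and rest: "successively A ks"
      using "2.prems"(1) by (cases ks; simp)+
    moreover have "P k \<noteq> []" and ne: "P j \<noteq> []" if "j \<in> set ks" for j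
      using "2.prems"(2) that by simp_all
    moreover have "hd ks \<in> set ks" using False by simp
    moreover have "hd (zigzag P (\<not> up) ks) = (if \<not> up then hd (P (hd ks)) else last (P (hd ks)))"
      by (rule zigzag_ends(2)[OF False ne])
    ultimately have "B (last (if up then P k else rev (P k))) (hd (zigzag P (\<not> up) ks))"
      using "2.prems"(5)[of k "hd ks"] by (auto simp: last_rev)
    moreover have "successively B (zigzag P (\<not> up) ks)"
      using "2.prems" by (intro "2.IH"[OF rest]) simp_all
    ultimately show ?thesis using first by (simp add: successively_append_iff)
  qed
qed simp

text \<open>This is the induction hypothesis. The first two clauses turn links into covers; the last
  one lets the empty face be attached at both ends.\<close>

definition tour :: "((nat \<times> nat) set \<times> (nat \<times> nat) set) set \<Rightarrow> nat \<Rightarrow> ((nat \<Rightarrow> real) \<Rightarrow> nat) \<Rightarrow>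
    ((nat \<times> nat) set set \<times> (nat \<times> nat) set set) list \<Rightarrow> bool" where
  "tour R n rk ks \<longleftrightarrow>
     (\<forall>c d. key R n c = key R n d \<longrightarrow> rk c = rk d) \<and>
     (\<forall>c d. lo n d \<subseteq> lo n c \<longrightarrow> hi n c \<subseteq> hi n d \<longrightarrow> key R n c \<noteq> key R n d \<longrightarrow> rk c < rk d) \<and>
     ks \<noteq> [] \<and> distinct ks \<and> set ks = range (key R n) \<and> successively (adj R n rk) ks \<and>
     (\<forall>c. key R n c = hd ks \<or> key R n c = last ks \<longrightarrow> rk c = 0)"

context congruence_Suc
begin

text \<open>The end conditions range over all representatives of \<open>k\<close>, because the faces
  that witness a link need not be the one from which the path was built.\<close>

definition fibre_path ::
    "((nat \<Rightarrow> real) \<Rightarrow> nat) \<Rightarrow> (nat \<times> nat) set set \<times> (nat \<times> nat) set set \<Rightarrow>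
     ((nat \<times> nat) set set \<times> (nat \<times> nat) set set) list \<Rightarrow> bool" where
  "fibre_path rank k ks \<longleftrightarrow> ks \<noteq> [] \<and>
     (\<forall>c t. key (R \<inter> inv_sets n \<times> inv_sets n) n c = k \<longrightarrow> (\<forall>b\<in>{1..n}. c b < t) \<longrightarrow> hd ks = K (c(Suc n := t))) \<and>
     (\<forall>c t. key (R \<inter> inv_sets n \<times> inv_sets n) n c = k \<longrightarrow> (\<forall>b\<in>{1..n}. t < c b) \<longrightarrow> last ks = K (c(Suc n := t))) \<and>
     distinct ks \<and> successively (adj R (Suc n) rank) ks \<and>
     set ks = {K c | c. key (R \<inter> inv_sets n \<times> inv_sets n) n c = k}"

text \<open>Any representative will do: by \<open>transport\<close> its path reaches the lifts of
  the others, and its ends depend only on the class, as their bounds are \<open>lo n c\<close> and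
  \<open>hi n c\<close> or the images of these under \<open>upper n\<close>.\<close>

lemma fibre_path_ex:
  fixes rk :: "(nat \<Rightarrow> real) \<Rightarrow> nat"
  defines "rank \<equiv> \<lambda>c. rk c + (if thin c then 0 else 1)"
    and "base \<equiv> key (R \<inter> inv_sets n \<times> inv_sets n) n"
  assumes rk: "\<And>c d. base c = base d \<Longrightarrow> rk c = rk d" and k: "k \<in> range base"
  shows "\<exists>ks. fibre_path rank k ks"
proof -
  interpret b: congruence n "R \<inter> inv_sets n \<times> inv_sets n" by (rule congruence_restrict)
  have base_eq: "base c = base d \<longleftrightarrow> lo n c \<approx> lo n d \<and> hi n c \<approx> hi n d" for c d
    unfolding base_def b.key_eq by (simp add: lo_in hi_in)
  have base_upd: "base (c(Suc n := t)) = base c" for c t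
    by (simp add: base_def key_def)
  obtain c where c: "base c = k" using k by auto
  obtain t where t: "\<forall>b\<in>{1..n}. c b < t" using ex_upper_bound by blast
  have "separated n (c(Suc n := t))" using t by (force simp: separated_def)
  from descending_path[OF _ this, of rk] rk base_upd
  obtain ks where ks: "ks \<noteq> []" "hd ks = K (c(Suc n := t))"
    "\<forall>s. (\<forall>b\<in>{1..n}. s < c b) \<longrightarrow> last ks = K (c(Suc n := s))" "distinct ks"
    "successively (adj R (Suc n) rank) ks" "set ks = {K (c(Suc n := s)) | s. s \<le> t}"
    unfolding rank_def by blast
  have top: "K (d(Suc n := s)) = K (c(Suc n := t))"
    if "base d = k" "\<forall>b\<in>{1..n}. d b < s" for d s
  proof -
    have "lo n d \<approx> lo n c" "hi n d \<approx> hi n c" using that(1) c base_eq[of d c] by simp_all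
    then show ?thesis by (simp add: K_eq lift_top that(2) t)
  qed
  have bottom: "K (d(Suc n := s)) = K (e(Suc n := u))"
    if "base d = k" "\<forall>b\<in>{1..n}. s < d b" "base e = k" "\<forall>b\<in>{1..n}. u < e b" for d s e u
  proof -
    have "lo n d \<approx> lo n e" "hi n d \<approx> hi n e" using that(1,3) base_eq[of d e] by simp_all
    then have "upper n (lo n d) \<approx> upper n (lo n e)" "upper n (hi n d) \<approx> upper n (hi n e)"
      by (simp_all add: rel_upper lo_in hi_in)
    then show ?thesis by (simp add: K_eq lift_bottom that(2,4))
  qed
  obtain s where s: "\<forall>b\<in>{1..n}. s < c b" using ex_lower_bound by blast
  have "{K c | c. base c = k} \<subseteq> set ks"
  proof
    fix x assume "x \<in> {K c | c. base c = k}"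
    then obtain d where d: "x = K d" "base d = k" by blast
    then have "lo n c \<approx> lo n d" "hi n c \<approx> hi n d" using c base_eq[of c d] by simp_all
    from transport[OF this] obtain u where "K (c(Suc n := u)) = K d" unfolding K_eq by blast
    with d(1) have u: "x = K (c(Suc n := u))" by simp
    show "x \<in> set ks"
    proof (cases "u \<le> t")
      case False
      \<comment> \<open>Values beyond \<open>t\<close> again put \<open>n + 1\<close> in last
        place.\<close>
      then have "x = K (c(Suc n := t))"
        unfolding u using t by (intro top) (use c in \<open>force+\<close>)
      then show ?thesis unfolding ks(6) by blast
    qed (use u ks(6) in blast)
  qed
  moreover have "set ks \<subseteq> {K c | c. base c = k}" unfolding ks(6) using base_upd c by blast
  ultimately have "set ks = {K c | c. base c = k}" by (rule equalityI[rotated])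
  moreover have "last ks = K (d(Suc n := u))" if "base d = k" "\<forall>b\<in>{1..n}. u < d b" for d u
    using ks(3) s bottom[OF c s that] by simp
  moreover have "hd ks = K (d(Suc n := u))" if "base d = k" "\<forall>b\<in>{1..n}. d b < u" for d u
    using ks(2) top[OF that] by simp
  ultimately have "fibre_path rank k ks"
    using ks(1,4,5) unfolding fibre_path_def base_def by simp
  then show ?thesis ..
qed

lemma tour_Suc:
  assumes "tour (R \<inter> inv_sets n \<times> inv_sets n) n rk ks"
  shows "\<exists>ks. tour R (Suc n) (\<lambda>c. rk c + (if thin c then 0 else 1)) ks"
proof -
  let ?R = "R \<inter> inv_sets n \<times> inv_sets n"
  define rank where "rank = (\<lambda>c. rk c + (if thin c then 0 else 1))"
  interpret b: congruence n ?R by (rule congruence_restrict)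
  let ?base = "key ?R n"
  have base_eq: "?base c = ?base d \<longleftrightarrow> lo n c \<approx> lo n d \<and> hi n c \<approx> hi n d" for c d
    unfolding b.key_eq by (simp add: lo_in hi_in)
  have base_upd: "?base (c(Suc n := t)) = ?base c" for c t
    by (simp add: key_def)
  have tour: "\<And>c d. ?base c = ?base d \<Longrightarrow> rk c = rk d"
     "\<And>c d. lo n d \<subseteq> lo n c \<Longrightarrow> hi n c \<subseteq> hi n d \<Longrightarrow> ?base c \<noteq> ?base d \<Longrightarrow> rk c < rk d"
     "ks \<noteq> []" "distinct ks" "set ks = range ?base" "successively (adj ?R n rk) ks"
     "\<And>c. ?base c = hd ks \<or> ?base c = last ks \<Longrightarrow> rk c = 0"
    using assms unfolding tour_def by blast+
  have "\<exists>p. fibre_path rank k p" if "k \<in> set ks" for k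
    using fibre_path_ex[of rk k, OF tour(1)] that unfolding tour(5) rank_def by simp
  then obtain P where P: "\<And>k. k \<in> set ks \<Longrightarrow> fibre_path rank k (P k)" by metis
  then have P_ne: "\<And>k. k \<in> set ks \<Longrightarrow> P k \<noteq> []"
    and P_hd: "\<And>c t. \<forall>b\<in>{1..n}. c b < t \<Longrightarrow> hd (P (?base c)) = K (c(Suc n := t))"
    and P_last: "\<And>c t. \<forall>b\<in>{1..n}. t < c b \<Longrightarrow> last (P (?base c)) = K (c(Suc n := t))"
    and P_distinct: "\<And>k. k \<in> set ks \<Longrightarrow> distinct (P k)"
    and P_succ: "\<And>k. k \<in> set ks \<Longrightarrow> successively (adj R (Suc n) rank) (P k)"
    and P_set: "\<And>k. k \<in> set ks \<Longrightarrow> set (P k) = {K c | c. ?base c = k}"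
    unfolding fibre_path_def tour(5) by simp_all
  have K_base: "?base c = ?base d" if "K c = K d" for c d
    using that rel_lo_restrict rel_hi_restrict unfolding base_eq K_eq by simp
  have rank_K: "rank c = rank d" if "K c = K d" for c d
    using tour(1)[OF K_base[OF that]] thin_cong[of c d] that unfolding K_eq rank_def by simp
  \<comment> \<open>Over equivalent faces \<open>strict_step\<close> makes the thinness summand
    jump. Otherwise \<open>rk\<close> increases, and by \<open>thin_mono\<close> the summand cannot
    drop.\<close>
  have rank_less: "rank c < rank d"
    if sub: "lo (Suc n) d \<subseteq> lo (Suc n) c" "hi (Suc n) c \<subseteq> hi (Suc n) d" and neq: "K c \<noteq> K d" for c d
  proof (cases "?base c = ?base d")
    case True
    then have "thin c \<and> \<not> thin d"
      using strict_step[OF sub] neq unfolding base_eq K_eq by blast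
    then show ?thesis using tour(1)[OF True] by (simp add: rank_def)
  next
    case False
    have "lo n d \<subseteq> lo n c" "hi n c \<subseteq> hi n d"
      using Int_mono[OF sub(1) subset_refl[of "pairs n"]] Int_mono[OF sub(2) subset_refl[of "pairs n"]]
      by simp_all
    then have "rk c < rk d" using tour(2) False by blast
    then show ?thesis using thin_mono[OF _ sub] by (auto simp: rank_def)
  qed
  \<comment> \<open>With \<open>n + 1\<close> last or first, lifts keep both the containment and the
    rank of the faces below them, so links carry over to both ends.\<close>
  have top_bottom: "linked R (Suc n) rank (hd (P k)) (hd (P k')) \<and> linked R (Suc n) rank (last (P k)) (last (P k'))"
    if lk: "linked ?R n rk k k'" for k k'
  proof -
    obtain c d where cd: "k = ?base c" "k' = ?base d" "lo n d \<subseteq> lo n c" "hi n c \<subseteq> hi n d"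
      "rk d = Suc (rk c)" using lk unfolding linked_def by blast
    obtain s u where s: "\<forall>b\<in>{1..n}. c b < s" and u: "\<forall>b\<in>{1..n}. d b < u"
      using ex_upper_bound by meson
    obtain s' u' where s': "\<forall>b\<in>{1..n}. s' < c b" and u': "\<forall>b\<in>{1..n}. u' < d b"
      using ex_lower_bound by meson
    have "separated n (c(Suc n := s))" "separated n (d(Suc n := u))"
      "separated n (c(Suc n := s'))" "separated n (d(Suc n := u'))"
      using s u s' u' by (force simp: separated_def)+
    then have ranks: "rank (c(Suc n := s)) = rk c" "rank (d(Suc n := u)) = rk d"
      "rank (c(Suc n := s')) = rk c" "rank (d(Suc n := u')) = rk d"
      using separated_thin tour(1)[OF base_upd] by (simp_all add: rank_def)
    have "upper n x \<subseteq> upper n y" if "x \<subseteq> y" for x y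
      using that by (auto simp: upper_def)
    then have "linked R (Suc n) rank (K (c(Suc n := s))) (K (d(Suc n := u)))"
      "linked R (Suc n) rank (K (c(Suc n := s'))) (K (d(Suc n := u')))"
      unfolding linked_def using cd(3-5) ranks lift_top[OF s] lift_top[OF u] lift_bottom[OF s'] lift_bottom[OF u']
      by (metis order_refl)+
    then show ?thesis
      unfolding cd(1,2) using P_hd[OF s] P_hd[OF u] P_last[OF s'] P_last[OF u'] by simp
  qed
  have ends: "rank c = 0" if "K c \<in> {hd (P k), last (P k)}" "k \<in> {hd ks, last ks}" for c k
  proof -
    have "k \<in> set ks" using that(2) tour(3) by auto
    then obtain d where d: "k = ?base d" unfolding tour(5) by auto
    then have 0: "rk d = 0" using tour(7)[of d] that(2) by auto
    obtain s where s: "\<forall>b\<in>{1..n}. d b < s" using ex_upper_bound by blast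
    obtain u where u: "\<forall>b\<in>{1..n}. u < d b" using ex_lower_bound by blast
    have "separated n (d(Suc n := s))" "separated n (d(Suc n := u))"
      using s u by (force simp: separated_def)+
    then have "rank (d(Suc n := s)) = 0" "rank (d(Suc n := u)) = 0"
      using separated_thin 0 tour(1)[OF base_upd] by (simp_all add: rank_def)
    moreover have "K c = K (d(Suc n := s)) \<or> K c = K (d(Suc n := u))"
      using that(1) P_hd[OF s] P_last[OF u] unfolding d by auto
    ultimately show ?thesis using rank_K by metis
  qed
  let ?z = "zigzag P True ks"
  have "successively (adj R (Suc n) rank) ?z"
  proof (rule successively_zigzag[OF tour(6) P_ne P_succ])
    show "adj R (Suc n) rank y x" if "adj R (Suc n) rank x y" for x y
      using that by (auto simp: adj_def)
    show "adj R (Suc n) rank (hd (P k)) (hd (P k')) \<and> adj R (Suc n) rank (last (P k)) (last (P k'))"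
      if "adj ?R n rk k k'" for k k'
      using that top_bottom unfolding adj_def by blast
  qed
  moreover have "distinct ?z"
  proof (rule distinct_zigzag[OF tour(4) P_distinct])
    show "set (P k) \<inter> set (P k') = {}"
      if kk: "k \<in> set ks" "k' \<in> set ks" "k \<noteq> k'" for k k'
    proof (rule equals0I)
      fix x assume "x \<in> set (P k) \<inter> set (P k')"
      then obtain c d where "x = K c" "?base c = k" "x = K d" "?base d = k'"
        unfolding Int_iff P_set[OF kk(1)] P_set[OF kk(2)] by blast
      with K_base[of c d] kk(3) show False by simp
    qed
  qed
  moreover have "set ?z = range K"
  proof -
    have "set ?z = (\<Union>k\<in>range ?base. {K c | c. ?base c = k})"
      unfolding set_zigzag using P_set tour(5) by simp
    also have "\<dots> = range K" by blast
    finally show ?thesis .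
  qed
  moreover have "rank c = 0" if c: "K c = hd ?z \<or> K c = last ?z" for c
  proof -
    have "hd ?z = hd (P (hd ks))" "last ?z \<in> {hd (P (last ks)), last (P (last ks))}"
      using zigzag_ends(2)[of ks P True] zigzag_ends(3)[of ks P True] tour(3) P_ne by simp_all
    with c show ?thesis using ends[of c "hd ks"] ends[of c "last ks"] by auto
  qed
  moreover have "?z \<noteq> []" using zigzag_ends(1)[of ks P True] tour(3) P_ne by simp
  ultimately have "tour R (Suc n) rank ?z"
    using rank_K rank_less unfolding tour_def by blast
  then show ?thesis unfolding rank_def ..
qed

end

theorem tour_ex:
  assumes "congruence n R"
  shows "\<exists>rk ks. tour R n rk ks"
  using assms
proof (induction n arbitrary: R)
  case 0
  \<comment> \<open>At size 0 there is a single face, a point of rank 0.\<close>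
  have lh: "lo 0 c = {}" "hi 0 c = {}" for c by (auto simp: lo_def hi_def)
  then have "tour R 0 (\<lambda>_. 0) [(R `` {{}}, R `` {{}})]"
    by (auto simp: tour_def key_def)
  then show ?case by blast
next
  case (Suc n)
  then interpret congruence_Suc n R by (simp add: congruence_Suc_def)
  from Suc.IH[OF congruence_restrict] show ?case using tour_Suc by blast
qed

subsection \<open>The faces of the permutahedron\<close>

definition position :: "(nat \<Rightarrow> nat) \<Rightarrow> nat \<Rightarrow> real" where
  "position \<pi> i = real (inv \<pi> i)"

definition face :: "nat \<Rightarrow> (nat \<Rightarrow> real) \<Rightarrow> (nat \<Rightarrow> nat) set" where
  "face n c = {\<pi> \<in> perms n. lo n c \<subseteq> inversions n \<pi> \<and> inversions n \<pi> \<subseteq> hi n c}"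

lemma inv_perms: "\<pi> \<in> perms n \<Longrightarrow> inv \<pi> permutes {1..n}"
  by (simp add: perms_def permutes_inv)

text \<open>A permutation is encoded by its positions, a function with singleton blocks, so facts
  about \<open>lo\<close> apply to it.\<close>

lemma inversions_eq_lo:
  assumes "\<pi> \<in> perms n"
  shows "inversions n \<pi> = lo n (position \<pi>)"
proof (intro equalityI subsetI)
  have p: "\<pi> permutes {1..n}" using assms by (simp add: perms_def)
  note q = permutes_in_image[OF p] permutes_in_image[OF permutes_inv[OF p]]
    permutes_inverses[OF p]
  fix x
  show "x \<in> lo n (position \<pi>)" if "x \<in> inversions n \<pi>"
  proof -
    from that obtain i j where "x = (\<pi> i, \<pi> j)" "i \<in> {1..n}" "j \<in> {1..n}" "i < j" "\<pi> i > \<pi> j"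
      by (auto simp: inversions_def)
    with q(1)[of i] q(1)[of j] q(4) show ?thesis by (simp add: lo_def position_def)
  qed
  show "x \<in> inversions n \<pi>" if x: "x \<in> lo n (position \<pi>)"
  proof -
    obtain a b where ab: "x = (a, b)" "1 \<le> b" "b < a" "a \<le> n" "inv \<pi> a < inv \<pi> b"
      using x by (auto simp: lo_def position_def)
    have "inv \<pi> a \<in> {1..n}" "inv \<pi> b \<in> {1..n}" using ab(2-4) q(2)[of a] q(2)[of b] by simp_all
    moreover have "x = (\<pi> (inv \<pi> a), \<pi> (inv \<pi> b))" using ab(1) q(3) by simp
    ultimately show ?thesis unfolding inversions_def
      by (intro CollectI exI[of _ "inv \<pi> a"] exI[of _ "inv \<pi> b"] conjI) (simp_all add: ab q(3))
  qed
qed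

lemma inversions_in: "\<pi> \<in> perms n \<Longrightarrow> inversions n \<pi> \<in> inv_sets n"
  by (simp add: inversions_eq_lo lo_in)

text \<open>Positions are recovered from comparisons alone. This serves both the injectivity of
  \<open>inversions\<close> and the formula for weights.\<close>

lemma permutes_position:
  assumes "p permutes {1..n}" "a \<in> {1..n}"
  shows "p a = Suc (card {b \<in> {1..n}. p b < p a})"
proof -
  note q = permutes_in_image[OF assms(1)]
  have "p ` {b \<in> {1..n}. p b < p a} = {1..<p a}"
  proof (intro equalityI subsetI)
    fix y assume y: "y \<in> {1..<p a}"
    then have "y \<in> {1..n}" using q[of a] assms(2) by simp
    then obtain b where "b \<in> {1..n}" "y = p b" using permutes_image[OF assms(1)] by blast
    then show "y \<in> p ` {b \<in> {1..n}. p b < p a}" using y by auto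
  next
    fix y assume "y \<in> p ` {b \<in> {1..n}. p b < p a}"
    then obtain b where "b \<in> {1..n}" "p b < p a" "y = p b" by blast
    then show "y \<in> {1..<p a}" using q[of b] by simp
  qed
  moreover have "inj_on p {b \<in> {1..n}. p b < p a}"
    using permutes_inj[OF assms(1)] by (rule inj_on_subset) simp
  note card_image[OF this]
  ultimately have "card {b \<in> {1..n}. p b < p a} = p a - 1" by simp
  moreover have "1 \<le> p a" using q[of a] assms(2) by simp
  ultimately show ?thesis by linarith
qed

lemma inversions_inject:
  assumes "\<pi> \<in> perms n" "\<rho> \<in> perms n" "inversions n \<pi> = inversions n \<rho>"
  shows "\<pi> = \<rho>"
proof -
  note p = inv_perms[OF assms(1)] and r = inv_perms[OF assms(2)]
  have lt: "inv \<pi> a < inv \<pi> b \<longleftrightarrow> inv \<rho> a < inv \<rho> b" if "a \<in> {1..n}" "b \<in> {1..n}" "b < a" for a b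
  proof -
    have "(a, b) \<in> lo n (position \<pi>) \<longleftrightarrow> (a, b) \<in> lo n (position \<rho>)"
      using assms by (simp add: inversions_eq_lo)
    then show ?thesis using that by (simp add: lo_def position_def)
  qed
  have inj: "inv \<pi> a \<noteq> inv \<pi> b" "inv \<rho> a \<noteq> inv \<rho> b" if "a \<noteq> b" for a b
    using that permutes_inj[OF p] permutes_inj[OF r] by (simp_all add: inj_eq)
  have lt': "inv \<pi> b < inv \<pi> a \<longleftrightarrow> inv \<rho> b < inv \<rho> a" if "a \<in> {1..n}" "b \<in> {1..n}" for a b
    using lt[of a b] lt[of b a] inj[of a b] that by (cases a b rule: linorder_cases) auto
  have "inv \<pi> a = inv \<rho> a" for a
  proof (cases "a \<in> {1..n}")
    case True
    then have "{b \<in> {1..n}. inv \<pi> b < inv \<pi> a} = {b \<in> {1..n}. inv \<rho> b < inv \<rho> a}"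
      using lt' by blast
    then show ?thesis using permutes_position[OF p True] permutes_position[OF r True] by simp
  next
    case False
    then show ?thesis using permutes_not_in[OF p] permutes_not_in[OF r] by simp
  qed
  then have "inv \<pi> = inv \<rho>" by blast
  then show ?thesis using assms(1,2) by (metis inv_inv_eq mem_Collect_eq perms_def permutes_bij)
qed

text \<open>The two closure conditions together say that \<open>before\<close> is a strict total
  order. Ranks in it are positions, so the permutation sought is the inverse of the rank function
  \<open>p\<close>.\<close>

lemma inversions_surj:
  assumes I: "I \<in> inv_sets n"
  obtains \<pi> where "\<pi> \<in> perms n" "inversions n \<pi> = I"
proof -
  define before where "before = (\<lambda>a b. a < b \<and> (b, a) \<notin> I \<or> b < a \<and> (a, b) \<in> I)"
  have tr: "before a c" if ab: "before a b" and bc: "before b c" for a b c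
  proof -
    note i = inv_sets_trans[OF I] inv_sets_cotrans[OF I]
    consider "a < b" "b < c" | "a < c" "c < b" | "b < a" "a < c" | "b < c" "c < a" | "c < a" "a < b"
      | "c < b" "b < a" | "a = c" | "a = b" | "b = c"
      by linarith
    then show ?thesis
    proof cases
      case 1
      with ab bc i(2)[of c a b] show ?thesis by (auto simp: before_def)
    next
      case 2
      with ab bc i(1)[of b c a] show ?thesis by (auto simp: before_def)
    next
      case 3
      with ab bc i(1)[of c a b] show ?thesis by (auto simp: before_def)
    next
      case 4
      with ab bc i(2)[of a b c] show ?thesis by (auto simp: before_def)
    next
      case 5
      with ab bc i(2)[of b c a] show ?thesis by (auto simp: before_def)
    next
      case 6
      with ab bc i(1)[of a b c] show ?thesis by (auto simp: before_def)
    qed (use ab bc in \<open>auto simp: before_def\<close>)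
  qed
  have tot: "before a b \<or> before b a" if "a \<noteq> b" for a b
    using that by (auto simp: before_def)
  have irr: "\<not> before a a" for a by (simp add: before_def)
  define p where "p = (\<lambda>a. if a \<in> {1..n} then Suc (card {b \<in> {1..n}. before b a}) else a)"
  have lt: "p a < p b" if "a \<in> {1..n}" "b \<in> {1..n}" "before a b" for a b
  proof -
    have "{x \<in> {1..n}. before x a} \<subseteq> {x \<in> {1..n}. before x b}" using tr[OF _ that(3)] by blast
    moreover have "a \<in> {x \<in> {1..n}. before x b}" "a \<notin> {x \<in> {1..n}. before x a}"
      using that irr by auto
    ultimately have "{x \<in> {1..n}. before x a} \<subset> {x \<in> {1..n}. before x b}" by blast
    then have "card {x \<in> {1..n}. before x a} < card {x \<in> {1..n}. before x b}"
      by (intro psubset_card_mono) simp_all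
    then show ?thesis using that by (simp add: p_def)
  qed
  have inj: "inj_on p {1..n}"
    by (rule inj_onI) (use lt tot in \<open>metis less_irrefl\<close>)
  have "p a \<in> {1..n}" if a: "a \<in> {1..n}" for a
  proof -
    have "{b \<in> {1..n}. before b a} \<subseteq> {1..n} - {a}" using irr by auto
    then have "card {b \<in> {1..n}. before b a} \<le> card ({1..n} - {a})" by (intro card_mono) simp_all
    then have "card {b \<in> {1..n}. before b a} \<le> n - 1" using a by simp
    moreover have "1 \<le> n" using a by simp
    ultimately have "Suc (card {b \<in> {1..n}. before b a}) \<le> n" by linarith
    with a show ?thesis by (simp add: p_def)
  qed
  then have "p ` {1..n} \<subseteq> {1..n}" by blast
  then have "p ` {1..n} = {1..n}" by (rule endo_inj_surj[OF finite_atLeastAtMost _ inj])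
  then have "p permutes {1..n}"
    using inj by (intro bij_imp_permutes) (auto simp: bij_betw_def p_def)
  then have perm: "inv p \<in> perms n" "inv (inv p) = p"
    by (simp_all add: perms_def permutes_inv permutes_inv_inv)
  have "inversions n (inv p) = I"
  proof (intro equalityI subrelI)
    fix a b assume "(a, b) \<in> inversions n (inv p)"
    then have ab: "1 \<le> b" "b < a" "a \<le> n" "p a < p b"
      by (simp_all add: inversions_eq_lo perm lo_def position_def)
    then have "\<not> before b a" using lt[of b a] by auto
    with ab show "(a, b) \<in> I" by (simp add: before_def)
  next
    fix a b assume ab: "(a, b) \<in> I"
    note bd = inv_sets_pairs[OF I ab]
    then have "p a < p b" using ab by (intro lt) (auto simp: before_def)
    with bd show "(a, b) \<in> inversions n (inv p)"
      by (simp add: inversions_eq_lo perm lo_def position_def)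
  qed
  with perm(1) show ?thesis by (rule that)
qed

lemma face_nonempty: "face n c \<noteq> {}"
proof -
  obtain \<pi> where "\<pi> \<in> perms n" "inversions n \<pi> = lo n c" by (rule inversions_surj[OF lo_in])
  then have "\<pi> \<in> face n c" by (simp add: face_def lo_subset_hi)
  then show ?thesis by blast
qed

definition weight :: "nat \<Rightarrow> (nat \<Rightarrow> real) \<Rightarrow> (nat \<Rightarrow> nat) \<Rightarrow> real" where
  "weight n c \<pi> = (\<Sum>i=1..n. c i * position \<pi> i)"

text \<open>The factor one half corrects for the double sum running over ordered pairs.\<close>

definition max_weight :: "nat \<Rightarrow> (nat \<Rightarrow> real) \<Rightarrow> real" where
  "max_weight n c = (\<Sum>i=1..n. c i) +
     (\<Sum>i=1..n. \<Sum>j=1..n. if i = j then 0 else max (c i) (c j)) / 2"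

text \<open>Writing a position as one plus the number of earlier entries turns the weight into a sum over
  pairs in which each pair contributes the value of its later element.\<close>

lemma weight_max:
  assumes "\<pi> \<in> perms n"
  shows "weight n c \<pi> \<le> max_weight n c"
    and "weight n c \<pi> = max_weight n c \<longleftrightarrow> \<pi> \<in> face n c"
proof -
  let ?p = "inv \<pi>"
  note p = inv_perms[OF assms]
  define f where "f = (\<lambda>i j. if ?p j < ?p i then c i else 0)"
  define g where "g = (\<lambda>i j. if i = j then 0 else max (c i) (c j))"
  have "c i * position \<pi> i = c i + (\<Sum>j=1..n. f i j)" if "i \<in> {1..n}" for i
  proof -
    have "(\<Sum>j=1..n. f i j) = c i * real (card {j \<in> {1..n}. ?p j < ?p i})"
      by (simp add: f_def sum.If_cases Int_def mult.commute)
    moreover have "position \<pi> i = 1 + real (card {j \<in> {1..n}. ?p j < ?p i})"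
      using permutes_position[OF p that] by (simp add: position_def)
    ultimately show ?thesis by (simp add: distrib_left)
  qed
  then have "weight n c \<pi> = (\<Sum>i=1..n. c i) + (\<Sum>i=1..n. \<Sum>j=1..n. f i j)"
    by (simp add: weight_def sum.distrib)
  \<comment> \<open>Symmetrising puts both contributions of a pair into one summand, which can then
    be compared with the maximum in \<open>g\<close>.\<close>
  moreover have "(\<Sum>i=1..n. \<Sum>j=1..n. f i j) = (\<Sum>i=1..n. \<Sum>j=1..n. f j i)"
    by (rule sum.swap)
  then have "(\<Sum>i=1..n. \<Sum>j=1..n. f i j) = (\<Sum>i=1..n. \<Sum>j=1..n. f i j + f j i) / 2"
    by (simp add: sum.distrib)
  moreover have "(\<Sum>i=1..n. \<Sum>j=1..n. g i j - (f i j + f j i)) =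
      (\<Sum>i=1..n. \<Sum>j=1..n. g i j) - (\<Sum>i=1..n. \<Sum>j=1..n. f i j + f j i)"
    by (simp add: sum_subtractf)
  moreover have "max_weight n c = (\<Sum>i=1..n. c i) + (\<Sum>i=1..n. \<Sum>j=1..n. g i j) / 2"
    unfolding max_weight_def g_def ..
  ultimately have diff: "max_weight n c - weight n c \<pi> =
      (\<Sum>i=1..n. \<Sum>j=1..n. g i j - (f i j + f j i)) / 2"
    by linarith
  have ne: "?p i \<noteq> ?p j" if "i \<noteq> j" for i j
    using that permutes_inj[OF p] by (simp add: inj_eq)
  have nonneg: "0 \<le> g i j - (f i j + f j i)" for i j
    using ne[of i j] by (auto simp: f_def g_def)
  then have "0 \<le> (\<Sum>i=1..n. \<Sum>j=1..n. g i j - (f i j + f j i))"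
    by (intro sum_nonneg)
  with diff show "weight n c \<pi> \<le> max_weight n c" by linarith
  have "weight n c \<pi> = max_weight n c \<longleftrightarrow> (\<Sum>i=1..n. \<Sum>j=1..n. g i j - (f i j + f j i)) = 0"
    using diff by auto
  also have "\<dots> \<longleftrightarrow> (\<forall>i\<in>{1..n}. \<forall>j\<in>{1..n}. g i j - (f i j + f j i) = 0)"
    using nonneg by (simp add: sum_nonneg_eq_0_iff sum_nonneg)
  \<comment> \<open>A summand vanishes iff the later entry carries the larger value; ties always
    vanish.\<close>
  also have "\<dots> \<longleftrightarrow> (\<forall>i\<in>{1..n}. \<forall>j\<in>{1..n}. c i < c j \<longrightarrow> ?p i < ?p j)"
  proof -
    have "g i j - (f i j + f j i) = 0 \<longleftrightarrow> (c i < c j \<longrightarrow> ?p i < ?p j) \<and> (c j < c i \<longrightarrow> ?p j < ?p i)" for i j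
      using ne[of i j] by (auto simp: f_def g_def max_def)
    then show ?thesis by blast
  qed
  also have "\<dots> \<longleftrightarrow> \<pi> \<in> face n c"
  proof
    assume r: "\<forall>i\<in>{1..n}. \<forall>j\<in>{1..n}. c i < c j \<longrightarrow> ?p i < ?p j"
    have "lo n c \<subseteq> lo n (position \<pi>)" using r by (auto simp: lo_def position_def)
    moreover have "lo n (position \<pi>) \<subseteq> hi n c"
    proof (rule subrelI)
      fix a b assume ab: "(a, b) \<in> lo n (position \<pi>)"
      then have "\<not> c b < c a" using r[rule_format, of b a] by (auto simp: lo_def position_def)
      with ab show "(a, b) \<in> hi n c" by (simp add: lo_def hi_def)
    qed
    ultimately show "\<pi> \<in> face n c" using assms by (simp add: face_def inversions_eq_lo)
  next
    assume "\<pi> \<in> face n c"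
    then have s: "lo n c \<subseteq> lo n (position \<pi>)" "lo n (position \<pi>) \<subseteq> hi n c"
      using assms by (simp_all add: face_def inversions_eq_lo)
    show "\<forall>i\<in>{1..n}. \<forall>j\<in>{1..n}. c i < c j \<longrightarrow> ?p i < ?p j"
    proof (intro ballI impI)
      fix i j assume ij: "i \<in> {1..n}" "j \<in> {1..n}" "c i < c j"
      consider "j < i" | "i < j" using ij(3) by (cases i j rule: linorder_cases) auto
      then show "?p i < ?p j"
      proof cases
        case 1
        then have "(i, j) \<in> lo n (position \<pi>)" using ij by (intro subsetD[OF s(1)]) (simp add: lo_def)
        then show ?thesis by (simp add: lo_def position_def)
      next
        case 2
        then have "(j, i) \<notin> lo n (position \<pi>)" using ij s(2) by (auto simp: hi_def dest!: subsetD)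
        then show ?thesis using 2 ij ne[of i j] by (auto simp: lo_def position_def)
      qed
    qed
  qed
  finally show "weight n c \<pi> = max_weight n c \<longleftrightarrow> \<pi> \<in> face n c" .
qed

lemma finite_perms: "finite (perms n)"
  by (simp add: perms_def finite_permutations)

lemma weight_point: "(\<Sum>i=1..n. c i * perm_point n \<pi> i) = weight n c \<pi>"
  by (simp add: weight_def perm_point_def position_def)

lemma point_in_permutahedron:
  assumes "\<pi> \<in> perms n"
  shows "perm_point n \<pi> \<in> permutahedron n"
  unfolding permutahedron_def
proof (intro CollectI exI[of _ "\<lambda>\<rho>. if \<rho> = \<pi> then 1 else 0 :: real"] conjI)
  show "perm_point n \<pi> = (\<lambda>i. \<Sum>\<rho>\<in>perms n. (if \<rho> = \<pi> then 1 else 0) * perm_point n \<rho> i)"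
    using assms by (simp add: if_distrib[of "\<lambda>x. x * _"] sum.delta finite_perms cong: if_cong)
qed (use assms in \<open>simp_all add: finite_perms\<close>)

lemma weight_permutahedron:
  assumes "x \<in> permutahedron n"
  shows "(\<Sum>i=1..n. c i * x i) \<le> max_weight n c"
proof -
  obtain w where w: "x = (\<lambda>i. \<Sum>\<pi>\<in>perms n. w \<pi> * perm_point n \<pi> i)" "\<forall>\<pi>\<in>perms n. 0 \<le> w \<pi>"
    "(\<Sum>\<pi>\<in>perms n. w \<pi>) = 1" using assms unfolding permutahedron_def by blast
  have "(\<Sum>i=1..n. c i * x i) = (\<Sum>i=1..n. \<Sum>\<pi>\<in>perms n. w \<pi> * (c i * perm_point n \<pi> i))"
    by (simp add: w(1) sum_distrib_left mult.left_commute)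
  also have "\<dots> = (\<Sum>\<pi>\<in>perms n. \<Sum>i=1..n. w \<pi> * (c i * perm_point n \<pi> i))"
    by (rule sum.swap)
  also have "\<dots> = (\<Sum>\<pi>\<in>perms n. w \<pi> * weight n c \<pi>)"
    by (simp add: weight_point[symmetric] sum_distrib_left)
  also have "\<dots> \<le> (\<Sum>\<pi>\<in>perms n. w \<pi> * max_weight n c)"
    using w(2) weight_max(1) by (intro sum_mono mult_left_mono) auto
  also have "\<dots> = max_weight n c" using w(3) by (simp add: sum_distrib_right[symmetric])
  finally show ?thesis .
qed

text \<open>If an inequality is attained at some permutation, its bound must be the maximal weight,
  because \<open>face n c\<close> is nonempty and attains that.\<close>

lemma perm_faces_eq: "perm_faces n = insert {} (range (face n))"
proof (intro equalityI subsetI)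
  fix A assume "A \<in> perm_faces n"
  then obtain c b where cb: "\<forall>x\<in>permutahedron n. (\<Sum>i=1..n. c i * x i) \<le> b"
    "A = {\<pi> \<in> perms n. perm_point n \<pi> \<in> {x \<in> permutahedron n. (\<Sum>i=1..n. c i * x i) = b}}"
    unfolding perm_faces_def is_face_def by blast
  have A: "A = {\<pi> \<in> perms n. weight n c \<pi> = b}"
    unfolding cb(2) mem_Collect_eq weight_point using point_in_permutahedron by blast
  have le: "weight n c \<pi> \<le> b" if "\<pi> \<in> perms n" for \<pi>
    using cb(1) point_in_permutahedron[OF that] weight_point by metis
  show "A \<in> insert {} (range (face n))"
  proof (cases "A = {}")
    case False
    then obtain \<pi> where \<pi>: "\<pi> \<in> perms n" "weight n c \<pi> = b" unfolding A by blast
    obtain \<sigma> where \<sigma>: "\<sigma> \<in> face n c" using face_nonempty by blast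
    then have "\<sigma> \<in> perms n" by (simp add: face_def)
    with \<sigma> have "max_weight n c \<le> b" using weight_max(2) le by metis
    with weight_max(1)[OF \<pi>(1), of c] \<pi>(2) have "b = max_weight n c" by simp
    then have "A = face n c" unfolding A using weight_max(2) by (auto simp: face_def)
    then show ?thesis by simp
  qed simp
next
  fix A assume "A \<in> insert {} (range (face n))"
  then consider "A = {}" | c where "A = face n c" by blast
  then show "A \<in> perm_faces n"
  proof cases
    case 1
    \<comment> \<open>The zero functional with bound 1 is valid and nowhere tight.\<close>
    have "is_face n {} (permutahedron n)"
      unfolding is_face_def by (intro exI[of _ "\<lambda>_. 0"] exI[of _ 1]) simp
    then show ?thesis unfolding perm_faces_def 1 by (intro CollectI exI[of _ "{}"]) simp
  next
    case 2
    let ?F = "{x \<in> permutahedron n. (\<Sum>i=1..n. c i * x i) = max_weight n c}"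
    have "is_face n ?F (permutahedron n)"
      unfolding is_face_def using weight_permutahedron by blast
    moreover have "A = {\<pi> \<in> perms n. perm_point n \<pi> \<in> ?F}"
      unfolding 2 mem_Collect_eq weight_point using weight_max(2) point_in_permutahedron
      by (auto simp: face_def)
    ultimately show ?thesis unfolding perm_faces_def by blast
  qed
qed

subsection \<open>The quotientope\<close>

definition inv_rel :: "nat \<Rightarrow> ((nat \<Rightarrow> nat) \<times> (nat \<Rightarrow> nat)) set \<Rightarrow> ((nat \<times> nat) set \<times> (nat \<times> nat) set) set" where
  "inv_rel n R = (\<lambda>(\<pi>, \<rho>). (inversions n \<pi>, inversions n \<rho>)) ` R"

text \<open>The join of the order is a choice among least upper bounds, so it is identified by
  showing that \<open>\<sigma>\<close> is the only one.\<close>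

lemma inversions_join:
  assumes "\<pi> \<in> perms n" "\<rho> \<in> perms n"
  shows "\<pi> \<squnion>\<^bsub>weak_order n\<^esub> \<rho> \<in> perms n \<and>
    inversions n (\<pi> \<squnion>\<^bsub>weak_order n\<^esub> \<rho>) = inv_join (inversions n \<pi>) (inversions n \<rho>)"
proof -
  let ?L = "weak_order n"
  note i = assms[THEN inversions_in]
  obtain \<sigma> where \<sigma>: "\<sigma> \<in> perms n" "inversions n \<sigma> = inv_join (inversions n \<pi>) (inversions n \<rho>)"
    by (rule inversions_surj[OF inv_join_in[OF i]])
  have up: "\<tau> \<in> Upper ?L {\<pi>, \<rho>} \<longleftrightarrow>
      \<tau> \<in> perms n \<and> inversions n \<pi> \<subseteq> inversions n \<tau> \<and> inversions n \<rho> \<subseteq> inversions n \<tau>" for \<tau>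
    using assms by (auto simp: Upper_def weak_order_def)
  have \<sigma>_up: "\<sigma> \<in> Upper ?L {\<pi>, \<rho>}"
    unfolding up \<sigma>(2) using \<sigma>(1) inv_join_ge by simp
  have \<sigma>_le: "inversions n \<sigma> \<subseteq> inversions n \<tau>" if "\<tau> \<in> Upper ?L {\<pi>, \<rho>}" for \<tau>
    unfolding \<sigma>(2) using that unfolding up by (intro inv_join_least[of _ n] inversions_in) simp_all
  have least: "least ?L \<tau> (Upper ?L {\<pi>, \<rho>}) \<longleftrightarrow> \<tau> = \<sigma>" for \<tau>
  proof
    assume "least ?L \<tau> (Upper ?L {\<pi>, \<rho>})"
    then have t: "\<tau> \<in> Upper ?L {\<pi>, \<rho>}" "inversions n \<tau> \<subseteq> inversions n \<sigma>"
      using \<sigma>_up by (auto simp: least_def weak_order_def)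
    then have "inversions n \<tau> = inversions n \<sigma>" using \<sigma>_le by (intro equalityI)
    then show "\<tau> = \<sigma>" using t(1) \<sigma>(1) inversions_inject unfolding up by blast
  next
    assume "\<tau> = \<sigma>"
    then show "least ?L \<tau> (Upper ?L {\<pi>, \<rho>})"
      using \<sigma>_up \<sigma>_le by (auto simp: least_def weak_order_def Upper_def)
  qed
  have "\<pi> \<squnion>\<^bsub>?L\<^esub> \<rho> = \<sigma>" unfolding join_def sup_def least by simp
  with \<sigma> show ?thesis by simp
qed

lemma inversions_meet:
  assumes "\<pi> \<in> perms n" "\<rho> \<in> perms n"
  shows "\<pi> \<sqinter>\<^bsub>weak_order n\<^esub> \<rho> \<in> perms n \<and>
    inversions n (\<pi> \<sqinter>\<^bsub>weak_order n\<^esub> \<rho>) = inv_meet n (inversions n \<pi>) (inversions n \<rho>)"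
proof -
  let ?L = "weak_order n"
  note i = assms[THEN inversions_in]
  obtain \<sigma> where \<sigma>: "\<sigma> \<in> perms n" "inversions n \<sigma> = inv_meet n (inversions n \<pi>) (inversions n \<rho>)"
    by (rule inversions_surj[OF inv_meet_in[OF i]])
  have lw: "\<tau> \<in> Lower ?L {\<pi>, \<rho>} \<longleftrightarrow>
      \<tau> \<in> perms n \<and> inversions n \<tau> \<subseteq> inversions n \<pi> \<and> inversions n \<tau> \<subseteq> inversions n \<rho>" for \<tau>
    using assms by (auto simp: Lower_def weak_order_def)
  have \<sigma>_lw: "\<sigma> \<in> Lower ?L {\<pi>, \<rho>}"
    unfolding lw \<sigma>(2) using \<sigma>(1) inv_meet_le[OF i] by simp
  have \<sigma>_ge: "inversions n \<tau> \<subseteq> inversions n \<sigma>" if "\<tau> \<in> Lower ?L {\<pi>, \<rho>}" for \<tau>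
    unfolding \<sigma>(2) using that unfolding lw by (intro inv_meet_greatest inversions_in) simp_all
  have greatest: "greatest ?L \<tau> (Lower ?L {\<pi>, \<rho>}) \<longleftrightarrow> \<tau> = \<sigma>" for \<tau>
  proof
    assume "greatest ?L \<tau> (Lower ?L {\<pi>, \<rho>})"
    then have t: "\<tau> \<in> Lower ?L {\<pi>, \<rho>}" "inversions n \<sigma> \<subseteq> inversions n \<tau>"
      using \<sigma>_lw by (auto simp: greatest_def weak_order_def)
    then have "inversions n \<tau> = inversions n \<sigma>" using \<sigma>_ge by (intro equalityI)
    then show "\<tau> = \<sigma>" using t(1) \<sigma>(1) inversions_inject unfolding lw by blast
  next
    assume "\<tau> = \<sigma>"
    then show "greatest ?L \<tau> (Lower ?L {\<pi>, \<rho>})"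
      using \<sigma>_lw \<sigma>_ge by (auto simp: greatest_def weak_order_def Lower_def)
  qed
  have "\<pi> \<sqinter>\<^bsub>?L\<^esub> \<rho> = \<sigma>" unfolding meet_def inf_def greatest by simp
  with \<sigma> show ?thesis by simp
qed

lemma inv_rel_iff:
  assumes "R \<subseteq> perms n \<times> perms n" "\<pi> \<in> perms n" "\<rho> \<in> perms n"
  shows "(inversions n \<pi>, inversions n \<rho>) \<in> inv_rel n R \<longleftrightarrow> (\<pi>, \<rho>) \<in> R"
proof
  assume "(inversions n \<pi>, inversions n \<rho>) \<in> inv_rel n R"
  then obtain \<pi>' \<rho>' where "(\<pi>', \<rho>') \<in> R" "inversions n \<pi> = inversions n \<pi>'" "inversions n \<rho> = inversions n \<rho>'"
    by (auto simp: inv_rel_def)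
  moreover from this assms have "\<pi> = \<pi>'" "\<rho> = \<rho>'"
    by (auto intro: inversions_inject)
  ultimately show "(\<pi>, \<rho>) \<in> R" by simp
qed (force simp: inv_rel_def)

lemma congruence_inv_rel:
  assumes "lattice_congruence (weak_order n) R"
  shows "congruence n (inv_rel n R)"
proof
  let ?R = "inv_rel n R"
  have eq: "equiv (perms n) R" and
    jm: "\<And>\<pi> \<pi>' \<rho> \<rho>'. (\<pi>, \<pi>') \<in> R \<Longrightarrow> (\<rho>, \<rho>') \<in> R \<Longrightarrow>
      (\<pi> \<squnion>\<^bsub>weak_order n\<^esub> \<rho>, \<pi>' \<squnion>\<^bsub>weak_order n\<^esub> \<rho>') \<in> R \<and>
      (\<pi> \<sqinter>\<^bsub>weak_order n\<^esub> \<rho>, \<pi>' \<sqinter>\<^bsub>weak_order n\<^esub> \<rho>') \<in> R"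
    using assms by (auto simp: lattice_congruence_def weak_order_def)
  have sub: "R \<subseteq> perms n \<times> perms n" using eq by (rule equiv_type)
  have E: "\<exists>\<pi> \<rho>. x = inversions n \<pi> \<and> y = inversions n \<rho> \<and> (\<pi>, \<rho>) \<in> R \<and> \<pi> \<in> perms n \<and> \<rho> \<in> perms n"
    if "(x, y) \<in> ?R" for x y
    using that sub by (force simp: inv_rel_def)
  have I: "(inversions n \<pi>, inversions n \<rho>) \<in> ?R" if "(\<pi>, \<rho>) \<in> R" for \<pi> \<rho>
    using that by (force simp: inv_rel_def)
  have "equiv (inv_sets n) ?R"
  proof (rule equivI)
    show "?R \<subseteq> inv_sets n \<times> inv_sets n"
      using E inversions_in by (intro subrelI) blast
    show "refl_on (inv_sets n) ?R"
    proof (rule refl_onI)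
      fix x assume "x \<in> inv_sets n"
      then obtain \<pi> where "\<pi> \<in> perms n" "inversions n \<pi> = x" by (rule inversions_surj)
      then show "(x, x) \<in> ?R" using I equiv_class_self[OF eq] by blast
    qed
    show "sym ?R"
      using E I equivE[OF eq] by (intro symI) (metis symE)
    show "trans ?R"
    proof (rule transI)
      fix x y z assume "(x, y) \<in> ?R" "(y, z) \<in> ?R"
      then obtain \<pi> \<rho> \<rho>' \<sigma> where *: "x = inversions n \<pi>" "y = inversions n \<rho>" "(\<pi>, \<rho>) \<in> R" "\<rho> \<in> perms n"
        "y = inversions n \<rho>'" "z = inversions n \<sigma>" "(\<rho>', \<sigma>) \<in> R" "\<rho>' \<in> perms n"
        using E by metis
      have "\<rho> = \<rho>'" by (rule inversions_inject[OF *(4,8)]) (use *(2,5) in simp)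
      then have "(\<pi>, \<sigma>) \<in> R" using *(3,7) eq by (meson equivE transE)
      with * I show "(x, z) \<in> ?R" by simp
    qed
  qed
  moreover have "(inv_join x y, inv_join x' y') \<in> ?R" "(inv_meet n x y, inv_meet n x' y') \<in> ?R"
    if xy: "(x, x') \<in> ?R" "(y, y') \<in> ?R" for x x' y y'
  proof -
    obtain \<pi> \<pi>' where p: "x = inversions n \<pi>" "x' = inversions n \<pi>'" "(\<pi>, \<pi>') \<in> R" "\<pi> \<in> perms n" "\<pi>' \<in> perms n"
      using E[OF xy(1)] by blast
    obtain \<rho> \<rho>' where r: "y = inversions n \<rho>" "y' = inversions n \<rho>'" "(\<rho>, \<rho>') \<in> R" "\<rho> \<in> perms n" "\<rho>' \<in> perms n"
      using E[OF xy(2)] by blast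
    show "(inv_join x y, inv_join x' y') \<in> ?R" "(inv_meet n x y, inv_meet n x' y') \<in> ?R"
      using I[OF conjunct1[OF jm[OF p(3) r(3)]]] I[OF conjunct2[OF jm[OF p(3) r(3)]]]
        inversions_join[OF p(4) r(4)] inversions_join[OF p(5) r(5)]
        inversions_meet[OF p(4) r(4)] inversions_meet[OF p(5) r(5)] p(1,2) r(1,2) by simp_all
  qed
  ultimately show "inv_congruence n ?R"
    unfolding inv_congruence_def by (intro conjI allI impI)
qed

lemma face_bounds:
  obtains \<pi> \<rho> where "\<pi> \<in> face n c" "inversions n \<pi> = lo n c" "\<rho> \<in> face n c" "inversions n \<rho> = hi n c"
proof -
  obtain \<pi> where \<pi>: "\<pi> \<in> perms n" "inversions n \<pi> = lo n c" by (rule inversions_surj[OF lo_in])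
  obtain \<rho> where \<rho>: "\<rho> \<in> perms n" "inversions n \<rho> = hi n c" by (rule inversions_surj[OF hi_in])
  show thesis by (rule that[of \<pi> \<rho>]) (use \<pi> \<rho> in \<open>simp_all add: face_def lo_subset_hi\<close>)
qed

lemma face_subset_iff: "face n c \<subseteq> face n d \<longleftrightarrow> lo n d \<subseteq> lo n c \<and> hi n c \<subseteq> hi n d"
proof
  assume sub: "face n c \<subseteq> face n d"
  obtain \<pi> \<rho> where b: "\<pi> \<in> face n c" "inversions n \<pi> = lo n c" "\<rho> \<in> face n c" "inversions n \<rho> = hi n c"
    by (rule face_bounds)
  then have "\<pi> \<in> face n d" "\<rho> \<in> face n d" using sub by auto
  with b show "lo n d \<subseteq> lo n c \<and> hi n c \<subseteq> hi n d" by (simp add: face_def)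
next
  assume "lo n d \<subseteq> lo n c \<and> hi n c \<subseteq> hi n d"
  then show "face n c \<subseteq> face n d" unfolding face_def by auto
qed

text \<open>Joining with \<open>lo n d\<close> and then meeting with \<open>hi n d\<close> maps into
  the interval of \<open>d\<close>. The same operations with the bounds of \<open>c\<close> fix
  every element of the interval of \<open>c\<close>, so the image stays in the class.\<close>

lemma face_dominated:
  assumes "congruence n R" "(lo n c, lo n d) \<in> R" "(hi n c, hi n d) \<in> R" "\<pi> \<in> face n c"
  shows "\<exists>\<rho>\<in>face n d. (inversions n \<pi>, inversions n \<rho>) \<in> R"
proof -
  interpret congruence n R by fact
  define z where "z = inversions n \<pi>"
  have z: "z \<in> inv_sets n" "lo n c \<subseteq> z" "z \<subseteq> hi n c"
    using assms(4) inversions_in by (auto simp: z_def face_def)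
  define w where "w = inv_meet n (inv_join z (lo n d)) (hi n d)"
  note j = inv_join_in[OF z(1) lo_in[of n d]]
  have w: "w \<in> inv_sets n" "lo n d \<subseteq> w" "w \<subseteq> hi n d"
    unfolding w_def
    by (rule inv_meet_in[OF j hi_in], rule inv_meet_greatest[OF lo_in inv_join_ge(2) lo_subset_hi],
        rule inv_meet_le(2)[OF j hi_in])
  have "(inv_meet n (inv_join z (lo n c)) (hi n c), w) \<in> R"
    unfolding w_def by (intro rel_meet rel_join rel_refl z(1) assms(2,3))
  moreover have "inv_join z (lo n c) = z"
    by (subst inv_join_commute) (rule inv_join_absorb[OF z(1,2)])
  moreover have "inv_meet n z (hi n c) = z" by (rule inv_meet_absorb[OF z(1) hi_in z(3)])
  ultimately have "(z, w) \<in> R" by simp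
  moreover obtain \<rho> where "\<rho> \<in> perms n" "inversions n \<rho> = w" by (rule inversions_surj[OF w(1)])
  ultimately show ?thesis using w(2,3) by (intro bexI[of _ \<rho>]) (simp_all add: z_def face_def)
qed

text \<open>Each bound of one face has a congruent partner within the other interval; the two
  resulting inequalities between classes identify the minima, and likewise the maxima. The converse
  is \<open>face_dominated\<close>.\<close>

lemma face_equiv_iff:
  assumes "lattice_congruence (weak_order n) R"
  shows "(face n c, face n d) \<in> face_equiv n R \<longleftrightarrow> key (inv_rel n R) n c = key (inv_rel n R) n d"
proof -
  let ?R = "inv_rel n R"
  interpret congruence n ?R by (rule congruence_inv_rel[OF assms])
  have sub: "R \<subseteq> perms n \<times> perms n"
    using assms equiv_type by (fastforce simp: lattice_congruence_def weak_order_def)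
  have I: "(inversions n \<pi>, inversions n \<rho>) \<in> ?R" if "(\<pi>, \<rho>) \<in> R" for \<pi> \<rho>
    using that by (force simp: inv_rel_def)
  have iff: "(inversions n \<pi>, inversions n \<rho>) \<in> ?R \<longleftrightarrow> (\<pi>, \<rho>) \<in> R"
    if "\<pi> \<in> face n c" "\<rho> \<in> face n d" for \<pi> \<rho>
    using inv_rel_iff[OF sub] that by (simp add: face_def)
  show ?thesis unfolding key_eq
  proof
    assume eq: "(face n c, face n d) \<in> face_equiv n R"
    have 1: "\<exists>\<rho>\<in>face n d. (inversions n \<pi>, inversions n \<rho>) \<in> ?R" if "\<pi> \<in> face n c" for \<pi>
      using eq that I unfolding face_equiv_def by blast
    have 2: "\<exists>\<rho>\<in>face n c. (inversions n \<rho>, inversions n \<pi>) \<in> ?R" if "\<pi> \<in> face n d" for \<pi>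
      using eq that I unfolding face_equiv_def by blast
    obtain \<pi> \<rho> where c: "\<pi> \<in> face n c" "inversions n \<pi> = lo n c" "\<rho> \<in> face n c" "inversions n \<rho> = hi n c"
      by (rule face_bounds)
    obtain \<pi>' \<rho>' where d: "\<pi>' \<in> face n d" "inversions n \<pi>' = lo n d" "\<rho>' \<in> face n d" "inversions n \<rho>' = hi n d"
      by (rule face_bounds)
    from 1[OF c(1)] obtain a where a: "(lo n c, a) \<in> ?R" "lo n d \<subseteq> a" using c(2) by (auto simp: face_def)
    from 2[OF d(1)] obtain b where b: "(b, lo n d) \<in> ?R" "lo n c \<subseteq> b" using d(2) by (auto simp: face_def)
    from 1[OF c(3)] obtain a' where a': "(hi n c, a') \<in> ?R" "a' \<subseteq> hi n d" using c(4) by (auto simp: face_def)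
    from 2[OF d(3)] obtain b' where b': "(b', hi n d) \<in> ?R" "b' \<subseteq> hi n c" using d(4) by (auto simp: face_def)
    have "(lo n c, b) \<in> ?R" by (rule rel_antisym[OF a(1) b(1,2) a(2)])
    moreover have "(b', hi n c) \<in> ?R" by (rule rel_antisym[OF b'(1) a'(1) b'(2) a'(2)])
    ultimately show "(lo n c, lo n d) \<in> ?R \<and> (hi n c, hi n d) \<in> ?R"
      using b(1) b'(1) rel_sym rel_trans by meson
  next
    assume k: "(lo n c, lo n d) \<in> ?R \<and> (hi n c, hi n d) \<in> ?R"
    have "\<exists>\<rho>\<in>face n d. (\<pi>, \<rho>) \<in> R" if "\<pi> \<in> face n c" for \<pi>
      using face_dominated[OF congruence_axioms _ _ that, of d] k iff[OF that] by blast
    moreover have "\<exists>\<pi>\<in>face n c. (\<pi>, \<rho>) \<in> R" if "\<rho> \<in> face n d" for \<rho>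
      using face_dominated[OF congruence_axioms _ _ that, of c] k iff[OF _ that] rel_sym by blast
    ultimately show "(face n c, face n d) \<in> face_equiv n R"
      by (simp add: face_equiv_def perm_faces_eq)
  qed
qed

lemma cyclic_successively:
  assumes "xs \<noteq> []" "successively E xs" "E (last xs) (hd xs)" "i < length xs"
  shows "E (xs ! i) (xs ! ((i + 1) mod length xs))"
proof (cases "Suc i < length xs")
  case True
  then show ?thesis using assms(2) by (simp add: successively_conv_nth)
next
  case False
  then have "i = length xs - 1" "Suc i = length xs" using assms(4) by simp_all
  then show ?thesis using assms(1,3) by (simp add: last_conv_nth hd_conv_nth)
qed

definition face_class :: "nat \<Rightarrow> ((nat \<times> nat) set \<times> (nat \<times> nat) set) set \<Rightarrow>
    (nat \<times> nat) set set \<times> (nat \<times> nat) set set \<Rightarrow> (nat \<Rightarrow> nat) set set" where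
  "face_class n R k = {face n c | c. key R n c = k}"

theorem theorem19:
  fixes n :: nat and R :: "((nat \<Rightarrow> nat) \<times> (nat \<Rightarrow> nat)) set"
  assumes "n \<ge> 1"
    and "lattice_congruence (weak_order n) R"
  shows "\<exists>xs. hamiltonian_cycle (carrier (quotientope_face_lattice n R))
                (cover_adjacent (quotientope_face_lattice n R)) xs"
proof -
  let ?R = "inv_rel n R" and ?L = "quotientope_face_lattice n R"
  define K where "K = key ?R n"
  define C where "C = face_class n ?R"
  note fe = face_equiv_iff[OF assms(2), folded K_def]
  obtain rk ks where "tour ?R n rk ks"
    using tour_ex[OF congruence_inv_rel[OF assms(2)]] by blast
  then have tour: "\<And>c d. K c = K d \<Longrightarrow> rk c = rk d"
     "\<And>c d. lo n d \<subseteq> lo n c \<Longrightarrow> hi n c \<subseteq> hi n d \<Longrightarrow> K c \<noteq> K d \<Longrightarrow> rk c < rk d"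
     "ks \<noteq> []" "distinct ks" "set ks = range K" "successively (adj ?R n rk) ks"
     "\<And>c. K c = hd ks \<or> K c = last ks \<Longrightarrow> rk c = 0"
    unfolding tour_def K_def by blast+
  have C_iff: "A \<in> C k \<longleftrightarrow> (\<exists>c. A = face n c \<and> K c = k)" for A k
    by (auto simp: C_def face_class_def K_def)
  have no_empty: "{} \<notin> C k" for k using C_iff face_nonempty by metis
  \<comment> \<open>A face attains its bounds and therefore determines them, so distinct keys have
    disjoint classes.\<close>
  have C_inj: "k = k'" if kk: "C k = C k'" "k \<in> range K" for k k'
  proof -
    obtain c where "k = K c" using kk(2) by blast
    then have "face n c \<in> C k" using C_iff by blast
    then have "face n c \<in> C k'" unfolding kk(1) .
    then obtain d where "face n c = face n d" "K d = k'" unfolding C_iff by blast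
    then have "lo n c = lo n d" "hi n c = hi n d"
      using face_subset_iff[of n c d] face_subset_iff[of n d c] by auto
    then show ?thesis using \<open>k = K c\<close> \<open>K d = k'\<close> by (simp add: K_def key_def)
  qed
  have class_face: "face_equiv n R `` {face n c} = C (K c)" for c
  proof (intro equalityI subsetI)
    fix A assume "A \<in> face_equiv n R `` {face n c}"
    then have A: "(face n c, A) \<in> face_equiv n R" by simp
    then have "A \<in> perm_faces n" "A \<noteq> {}" using face_nonempty by (auto simp: face_equiv_def)
    then obtain d where "A = face n d" by (auto simp: perm_faces_eq)
    then show "A \<in> C (K c)" using A fe[of c d] unfolding C_iff by auto
  next
    fix A assume "A \<in> C (K c)"
    then obtain d where "A = face n d" "K d = K c" unfolding C_iff by blast
    then show "A \<in> face_equiv n R `` {face n c}" using fe[of c d] by simp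
  qed
  have class_empty: "face_equiv n R `` {{}} = {{}}"
    by (auto simp: face_equiv_def perm_faces_eq)
  have "perm_faces n // face_equiv n R = insert {{}} (range (\<lambda>c. C (K c)))"
    unfolding quotient_def perm_faces_eq using class_face class_empty by auto
  then have carrier: "carrier ?L = insert {{}} (C ` set ks)"
    by (simp add: quotientope_face_lattice_def tour(5) image_image)
  have le: "A \<sqsubseteq>\<^bsub>?L\<^esub> B \<longleftrightarrow> (\<exists>F\<in>A. \<exists>F'\<in>B. F \<subseteq> F')" and less: "A \<sqsubset>\<^bsub>?L\<^esub> B \<longleftrightarrow> A \<sqsubseteq>\<^bsub>?L\<^esub> B \<and> A \<noteq> B"
    for A B by (simp_all add: quotientope_face_lattice_def lless_def)
  have not_less_empty: "\<not> A \<sqsubset>\<^bsub>?L\<^esub> {{}}" if "A \<in> carrier ?L" for A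
    using that no_empty unfolding carrier less le by auto
  \<comment> \<open>Comparability of classes only provides some nested representatives; constancy of
    \<open>rk\<close> on classes transfers the inequality.\<close>
  have rk_less: "rk c < rk d" if cd: "C (K c) \<sqsubset>\<^bsub>?L\<^esub> C (K d)" for c d
  proof -
    obtain c' d' where "face n c' \<subseteq> face n d'" "K c' = K c" "K d' = K d"
      using conjunct1[OF cd[unfolded less]] unfolding le Bex_def C_iff by blast
    moreover from this cd have "K c' \<noteq> K d'" unfolding less by auto
    ultimately show ?thesis using tour(1)[of c' c] tour(1)[of d' d] tour(2)[of d' c']
      unfolding face_subset_iff by simp
  qed
  have carrierE: thesis if "A \<in> carrier ?L" "A = {{}} \<Longrightarrow> thesis" "\<And>c. A = C (K c) \<Longrightarrow> thesis" for A thesis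
    using that unfolding carrier tour(5) by blast
  have C_carrier: "C (K c) \<in> carrier ?L" for c unfolding carrier tour(5) by blast
  have cover_linked: "covers ?L (C k) (C k')" if lk: "linked ?R n rk k k'" for k k'
  proof -
    obtain c d where cd: "k = K c" "k' = K d" "face n c \<subseteq> face n d" "rk d = Suc (rk c)"
      using lk unfolding linked_def K_def face_subset_iff by blast
    have "face n c \<in> C (K c)" "face n d \<in> C (K d)" unfolding C_iff by blast+
    then have "C (K c) \<sqsubseteq>\<^bsub>?L\<^esub> C (K d)" unfolding le using cd(3) by blast
    moreover have "K c \<noteq> K d" using tour(1)[of c d] cd(4) by auto
    then have "C (K c) \<noteq> C (K d)" using C_inj[of "K c" "K d"] by auto
    ultimately have "C (K c) \<sqsubset>\<^bsub>?L\<^esub> C (K d)" unfolding less ..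
    \<comment> \<open>A class in between would have a rank strictly between two consecutive
      integers, and the empty face lies above nothing.\<close>
    moreover have "\<not> (C (K c) \<sqsubset>\<^bsub>?L\<^esub> A \<and> A \<sqsubset>\<^bsub>?L\<^esub> C (K d))" if A: "A \<in> carrier ?L" for A
      using A
    proof (rule carrierE)
      assume "A = {{}}"
      then show ?thesis using not_less_empty[OF C_carrier] by blast
    next
      fix e assume "A = C (K e)"
      then show ?thesis using rk_less[of c e] rk_less[of e d] cd(4) by auto
    qed
    ultimately show ?thesis unfolding covers_def cd(1,2) using C_carrier by blast
  qed
  have cover_empty: "covers ?L {{}} (C (K c))" if "rk c = 0" for c
  proof -
    have "{{}} \<sqsubset>\<^bsub>?L\<^esub> C (K c)"
      unfolding less le using no_empty[of "K c"] C_iff[of "face n c" "K c"] by blast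
    moreover have "\<not> ({{}} \<sqsubset>\<^bsub>?L\<^esub> A \<and> A \<sqsubset>\<^bsub>?L\<^esub> C (K c))" if A: "A \<in> carrier ?L" for A
      using A
    proof (rule carrierE)
      assume "A = {{}}"
      then show ?thesis by (simp add: less)
    next
      fix e assume "A = C (K e)"
      then show ?thesis using rk_less[of e c] that \<open>rk c = 0\<close> by auto
    qed
    moreover have "{{}} \<in> carrier ?L" unfolding carrier by simp
    ultimately show ?thesis unfolding covers_def using C_carrier by blast
  qed
  \<comment> \<open>If there is only one nonempty class, this list has two members and the cycle is
    the edge traversed back and forth.\<close>
  let ?xs = "{{}} # map C ks"
  have ends: "covers ?L {{}} (C (hd ks))" "covers ?L {{}} (C (last ks))"
  proof -
    have "hd ks \<in> range K" "last ks \<in> range K" using tour(3) unfolding tour(5)[symmetric] by simp_all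
    then obtain c d where "hd ks = K c" "last ks = K d" by blast
    then show "covers ?L {{}} (C (hd ks))" "covers ?L {{}} (C (last ks))"
      using cover_empty[of c] cover_empty[of d] tour(7)[of c] tour(7)[of d] by simp_all
  qed
  have "successively (cover_adjacent ?L) (map C ks)"
    unfolding successively_map
    by (rule successively_mono[OF tour(6)]) (use cover_linked in \<open>auto simp: adj_def cover_adjacent_def\<close>)
  then have succ: "successively (cover_adjacent ?L) ?xs"
    using ends(1) tour(3) by (simp add: successively_Cons cover_adjacent_def hd_map)
  have last: "cover_adjacent ?L (last ?xs) (hd ?xs)"
    using ends(2) tour(3) by (simp add: cover_adjacent_def last_map)
  have "inj_on C (set ks)" using C_inj unfolding tour(5) by (intro inj_onI) blast
  then have "distinct ?xs"
    using tour(4) no_empty by (auto simp: distinct_map)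
  moreover have "set ?xs = carrier ?L" unfolding carrier by simp
  ultimately have "hamiltonian_cycle (carrier ?L) (cover_adjacent ?L) ?xs"
    unfolding hamiltonian_cycle_def using cyclic_successively[OF _ succ last] by blast
  then show ?thesis ..
qed

end
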